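(* Let $G$ be a separable TSI Lie group whose identity component $G_0$ is (topologically isomorphic to) the additive group $\mathbb R$, and let $\iota_{\mathbb R}:\mathbb R\to\mathbb R$, $\iota_{\mathbb R}(t)=-t$. Then (1) $E(G)\sim_B E(\mathbb R)$ if and only if $\mathrm{Inn}_G(G_0)=\{\mathrm{id}_{\mathbb R}\}$; (2) $E(G)\sim_B E(\mathbb Z_2\ltimes\mathbb R)$ if and only if $\mathrm{Inn}_G(G_0)=\{\mathrm{id}_{\mathbb R},\iota_{\mathbb R}\}$.
   Context: For a Polish group $G$, $E(G)$ is the equivalence relation on $G^\omega$ given by $x\,E(G)\,y$ iff $(x(n)y(n)^{-1})_n$ converges in $G$; $E\sim_B F$ means mutual Borel reducibility. TSI means admitting a compatible two-sided invariant metric. $\mathrm{Inn}_G(G_0)=\{\iota_u:u\in G\}$ where $\iota_u:G_0\to G_0$, $\iota_u(g)=ugu^{-1}$ (viewed as automorphisms of $\mathbb R$ via the identification $G_0\cong\mathbb R$). $\mathbb Z_2\ltimes\mathbb R$ is the semidirect product $\{0,1\}\times\mathbb R$ with $(\lambda_1,s)(\lambda_2,t)=(\lambda_1+\lambda_2 \bmod 2,\ s+(-1)^{\lambda_1}t)$ and the product topology. *)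

theory Defs
  imports "HOL-Analysis.Analysis" "HOL-Algebra.Group"
begin

section \<open>Topological groups\<close>

definition topological_group :: "('a, 'm) monoid_scheme \<Rightarrow> 'a topology \<Rightarrow> bool" where
  "topological_group G T \<longleftrightarrow>
     group G \<and> topspace T = carrier G \<and>
     continuous_map (prod_topology T T) T (\<lambda>(x, y). x \<otimes>\<^bsub>G\<^esub> y) \<and>
     continuous_map T T (\<lambda>x. inv\<^bsub>G\<^esub> x)"

definition TSI :: "('a, 'm) monoid_scheme \<Rightarrow> 'a topology \<Rightarrow> bool" where
  "TSI G T \<longleftrightarrow>
     (\<exists>d. Metric_space (carrier G) d \<and> Metric_space.mtopology (carrier G) d = T \<and>
        (\<forall>x\<in>carrier G. \<forall>y\<in>carrier G. \<forall>z\<in>carrier G.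
           d (z \<otimes>\<^bsub>G\<^esub> x) (z \<otimes>\<^bsub>G\<^esub> y) = d x y \<and>
           d (x \<otimes>\<^bsub>G\<^esub> z) (y \<otimes>\<^bsub>G\<^esub> z) = d x y))"

definition identity_component :: "('a, 'm) monoid_scheme \<Rightarrow> 'a topology \<Rightarrow> 'a set" where
  "identity_component G T = connected_component_of_set T \<one>\<^bsub>G\<^esub>"

definition topological_group_iso ::
  "('a, 'm) monoid_scheme \<Rightarrow> 'a topology \<Rightarrow> ('b, 'n) monoid_scheme \<Rightarrow> 'b topology \<Rightarrow> ('a \<Rightarrow> 'b) \<Rightarrow> bool" where
  "topological_group_iso G S H T f \<longleftrightarrow> f \<in> iso G H \<and> homeomorphic_map S T f"

definition inner_automorphisms_on :: "('a, 'm) monoid_scheme \<Rightarrow> 'a set \<Rightarrow> ('a \<Rightarrow> 'a) set" where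
  "inner_automorphisms_on G N =
     {(\<lambda>g\<in>N. u \<otimes>\<^bsub>G\<^esub> g \<otimes>\<^bsub>G\<^esub> inv\<^bsub>G\<^esub> u) | u. u \<in> carrier G}"

text \<open>Self-maps of \<open>N\<close> regarded as self-maps of \<open>'b\<close> along an identification \<open>\<theta>\<close> of \<open>N\<close> with \<open>'b\<close>.\<close>

definition transport_along :: "('a \<Rightarrow> 'b) \<Rightarrow> 'a set \<Rightarrow> ('a \<Rightarrow> 'a) set \<Rightarrow> ('b \<Rightarrow> 'b) set" where
  "transport_along \<theta> N A = (\<lambda>\<alpha>. \<theta> \<circ> \<alpha> \<circ> inv_into N \<theta>) ` A"


section \<open>Lie groups\<close>

text \<open>The notions below are only meant for open \<open>S\<close>.\<close>

primrec Ck_on :: "nat \<Rightarrow> 'e::euclidean_space set \<Rightarrow> ('e \<Rightarrow> 'f::euclidean_space) \<Rightarrow> bool" where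
  "Ck_on 0 S f \<longleftrightarrow> continuous_on S f"
| "Ck_on (Suc k) S f \<longleftrightarrow>
     (\<forall>x\<in>S. f differentiable (at x)) \<and> (\<forall>v. Ck_on k S (\<lambda>x. frechet_derivative f (at x) v))"

definition smooth_on :: "'e::euclidean_space set \<Rightarrow> ('e \<Rightarrow> 'f::euclidean_space) \<Rightarrow> bool" where
  "smooth_on S f \<longleftrightarrow> (\<forall>k. Ck_on k S f)"

type_synonym ('a, 'e) chart = "'a set \<times> ('a \<Rightarrow> 'e)"

definition is_chart :: "'a topology \<Rightarrow> ('a, 'e::euclidean_space) chart \<Rightarrow> bool" where
  "is_chart T = (\<lambda>(U, \<phi>). openin T U \<and> open (\<phi> ` U) \<and>
     homeomorphic_map (subtopology T U) (top_of_set (\<phi> ` U)) \<phi>)"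

definition smooth_atlas :: "'a topology \<Rightarrow> ('a, 'e::euclidean_space) chart set \<Rightarrow> bool" where
  "smooth_atlas T A \<longleftrightarrow>
     (\<forall>c\<in>A. is_chart T c) \<and> (\<Union>(U, \<phi>)\<in>A. U) = topspace T \<and>
     (\<forall>(U, \<phi>)\<in>A. \<forall>(V, \<psi>)\<in>A. smooth_on (\<phi> ` (U \<inter> V)) (\<psi> \<circ> inv_into U \<phi>))"

definition prod_atlas ::
  "('a, 'e) chart set \<Rightarrow> ('b, 'f) chart set \<Rightarrow> ('a \<times> 'b, 'e \<times> 'f) chart set" where
  "prod_atlas A B = {(U \<times> V, map_prod \<phi> \<psi>) | U \<phi> V \<psi>. (U, \<phi>) \<in> A \<and> (V, \<psi>) \<in> B}"

text \<open>Continuity makes the domain of each coordinate representation open.\<close>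

definition smooth_map ::
  "'a topology \<Rightarrow> ('a, 'e::euclidean_space) chart set \<Rightarrow>
   'b topology \<Rightarrow> ('b, 'f::euclidean_space) chart set \<Rightarrow> ('a \<Rightarrow> 'b) \<Rightarrow> bool" where
  "smooth_map S A T B f \<longleftrightarrow> continuous_map S T f \<and>
     (\<forall>(U, \<phi>)\<in>A. \<forall>(V, \<psi>)\<in>B. smooth_on (\<phi> ` (U \<inter> f -` V)) (\<psi> \<circ> f \<circ> inv_into U \<phi>))"

text \<open>
  No countability axiom is imposed on the underlying manifold, so separability is a genuine
  additional hypothesis. The model space \<open>'e\<close> ranges over all Euclidean spaces of dimension
  at least 1; the Lie groups left out are exactly the discrete ones.
\<close>

definition lie_group ::
  "('a, 'm) monoid_scheme \<Rightarrow> 'a topology \<Rightarrow> ('a, 'e::euclidean_space) chart set \<Rightarrow> bool" where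
  "lie_group G T A \<longleftrightarrow>
     topological_group G T \<and> Hausdorff_space T \<and> smooth_atlas T A \<and>
     smooth_map (prod_topology T T) (prod_atlas A A) T A (\<lambda>(x, y). x \<otimes>\<^bsub>G\<^esub> y) \<and>
     smooth_map T A T A (\<lambda>x. inv\<^bsub>G\<^esub> x)"


section \<open>Borel reducibility and the equivalence relation of a topological group\<close>

definition borel_of :: "'a topology \<Rightarrow> 'a measure" where
  "borel_of X = sigma (topspace X) {U. openin X U}"

definition borel_reducible :: "'a topology \<Rightarrow> 'a rel \<Rightarrow> 'b topology \<Rightarrow> 'b rel \<Rightarrow> bool" where
  "borel_reducible X E Y F \<longleftrightarrow>
     (\<exists>f \<in> borel_of X \<rightarrow>\<^sub>M borel_of Y.
        \<forall>x\<in>topspace X. \<forall>y\<in>topspace X. (x, y) \<in> E \<longleftrightarrow> (f x, f y) \<in> F)"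

definition borel_bireducible :: "'a topology \<Rightarrow> 'a rel \<Rightarrow> 'b topology \<Rightarrow> 'b rel \<Rightarrow> bool" where
  "borel_bireducible X E Y F \<longleftrightarrow> borel_reducible X E Y F \<and> borel_reducible Y F X E"

definition seq_topology :: "'a topology \<Rightarrow> (nat \<Rightarrow> 'a) topology" where
  "seq_topology T = product_topology (\<lambda>_. T) UNIV"

definition E_rel :: "('a, 'm) monoid_scheme \<Rightarrow> 'a topology \<Rightarrow> (nat \<Rightarrow> 'a) rel" where
  "E_rel G T =
     {(x, y). (\<forall>n. x n \<in> carrier G) \<and> (\<forall>n. y n \<in> carrier G) \<and>
        (\<exists>l. limitin T (\<lambda>n. x n \<otimes>\<^bsub>G\<^esub> inv\<^bsub>G\<^esub> (y n)) l sequentially)}"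

definition E_bireducible ::
  "('a, 'm) monoid_scheme \<Rightarrow> 'a topology \<Rightarrow> ('b, 'n) monoid_scheme \<Rightarrow> 'b topology \<Rightarrow> bool" where
  "E_bireducible G S H T \<longleftrightarrow>
     borel_bireducible (seq_topology S) (E_rel G S) (seq_topology T) (E_rel H T)"


section \<open>The groups \<open>\<real>\<close> and \<open>\<int>\<^sub>2 \<ltimes> \<real>\<close>\<close>

definition real_group :: "real monoid" where
  "real_group = \<lparr>carrier = UNIV, monoid.mult = (+), one = 0\<rparr>"

definition Z2_ltimes_R :: "(nat \<times> real) monoid" where
  "Z2_ltimes_R =
     \<lparr>carrier = {0, 1} \<times> UNIV,
      monoid.mult = (\<lambda>(a, s) (b, t). ((a + b) mod 2, s + (- 1) ^ a * t)),
      one = (0, 0)\<rparr>"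

definition Z2_ltimes_R_topology :: "(nat \<times> real) topology" where
  "Z2_ltimes_R_topology = prod_topology (discrete_topology {0, 1}) euclideanreal"

end

theory Submission
  imports Defs "HOL-Library.Omega_Words_Fun" "HOL-Algebra.Coset"
begin

text \<open>
  Conjugation by \<open>u \<in> G\<close> acts on \<open>G\<^sub>0 \<cong> \<real>\<close> as multiplication by a real number, which is \<open>1\<close> or
  \<open>- 1\<close> because of the two-sided invariant metric. Hence there are two cases only, and it suffices
  to reduce in both directions in each case and to show that \<open>E(\<int>\<^sub>2 \<ltimes> \<real>)\<close> is not reducible
  to \<open>E(\<real>)\<close>.

  For the reductions, the increments \<open>x(n)\<^sup>-\<^sup>1 x(n + 1)\<close> are written as \<open>s(e\<^sub>n) r\<^sub>n\<close> with a section
  \<open>s\<close> of the countable discrete quotient \<open>G / G\<^sub>0\<close> and \<open>r\<^sub>n \<in> G\<^sub>0\<close>. Then \<open>x E(G) y\<close> means that the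
  cosets \<open>e\<^sub>n\<close> of \<open>x\<close> and \<open>y\<close> agree eventually and that the series of the differences of the
  \<open>r\<^sub>n\<close>, signed by the action of \<open>x(n + 1)\<close>, converges.

  Suppose that \<open>f\<close> reduces \<open>E(\<int>\<^sub>2 \<ltimes> \<real>)\<close> to \<open>E(\<real>)\<close>. A Baire category argument produces
  words, with freely chosen increments at sparse sites, on which \<open>f\<close> is a concatenation of blocks,
  each depending on the choice at one site only, up to a summable error. So the convergence of
  \<open>f(x) - f(y)\<close> depends only on the sites at which \<open>x\<close> and \<open>y\<close> differ. But sign flips common to
  \<open>x\<close> and \<open>y\<close> turn a divergent series of positive terms into an alternating convergent one.
\<close>

section \<open>Baire category in the space of infinite words\<close>

text \<open>The obstacle to the non-reduction is that \<open>f\<close> is merely Borel: no value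
  \<open>f x n\<close> need depend on finitely many letters of \<open>x\<close>. Fillers
  \<open>w j\<close> placed before the sites remove this defect up to errors
  \<open>(1/2) ^ j\<close>, but Baire category gives no information on the fillers themselves, which
  may contain flips and translations. The translations cancel, because the words compared share both
  fillers and signs. The flips do not cancel, so the sites to be flipped are chosen only after the
  fillers are known, and compensate for their signs. The additive structure of the target enters
  through alternating sums of four values of \<open>f\<close>: two pairs of words that differ at the
  same sites and in the same way have equal differences of values modulo convergent sequences. For
  the reductions, a chart at the identity makes the identity component open, so the quotient is
  discrete, and separability makes it countable. Hence cosets can be coded by natural numbers, and a
  real sequence can carry these codes.\<close>

text \<open>This is the Baire property, with the meager error written as the complement of an
  intersection of countably many dense open sets. The induction follows the generation of the Borel
  sets.\<close>

lemma borel_open_modulo_dense: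
  fixes A :: "'a::topological_space set"
  assumes "A \<in> sets borel"
  shows "\<exists>U \<D>. open U \<and> countable \<D> \<and> (\<forall>V\<in>\<D>. open V \<and> closure V = UNIV) \<and>
           A \<inter> \<Inter>\<D> = U \<inter> \<Inter>\<D>"
proof -
  define Q where "Q A U \<D> \<longleftrightarrow> open U \<and> countable \<D> \<and> (\<forall>V\<in>\<D>. open V \<and> closure V = UNIV) \<and>
           A \<inter> \<Inter>\<D> = U \<inter> \<Inter>\<D>" for A U :: "'a set" and \<D>
  have "A \<in> sigma_sets UNIV {S. open S}"
    using assms by (simp add: borel_def)
  then have "\<exists>U \<D>. Q A U \<D>"
  proof induction
    case (Basic a)
    then have "Q a a {}" by (simp add: Q_def)
    then show ?case by blast
  next
    case Empty
    have "Q {} {} {}" by (simp add: Q_def)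
    then show ?case by blast
  next
    case (Compl a)
    then obtain U \<D> where Q: "Q a U \<D>" by blast
    \<comment> \<open>The exterior of \<open>U\<close> serves as the open set for the complement; it
      misses only the boundary of \<open>U\<close>, which the dense open set \<open>?W\<close>
      excludes.\<close>
    let ?W = "U \<union> - closure U"
    have "closure ?W = UNIV"
      using closure_subset[of "- closure U"] by (auto simp: closure_Un)
    moreover have "(UNIV - a) \<inter> \<Inter>(insert ?W \<D>) = (- closure U) \<inter> \<Inter>(insert ?W \<D>)"
      using Q closure_subset[of U] unfolding Q_def by blast
    moreover have "open ?W" "open (- closure U)" "countable (insert ?W \<D>)"
      using Q unfolding Q_def by auto
    ultimately have "Q (UNIV - a) (- closure U) (insert ?W \<D>)"
      using Q unfolding Q_def by simp
    then show ?case by blast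
  next
    case (Union a)
    then obtain U \<D> where Q: "\<And>i::nat. Q (a i) (U i) (\<D> i)" by metis
    have "a i \<inter> \<Inter>(\<Union>i. \<D> i) = U i \<inter> \<Inter>(\<Union>i. \<D> i)" for i
      using Q[of i] unfolding Q_def by blast
    then have "(\<Union>i. a i) \<inter> \<Inter>(\<Union>i. \<D> i) = (\<Union>i. U i) \<inter> \<Inter>(\<Union>i. \<D> i)"
      by blast
    moreover have "\<forall>V\<in>(\<Union>i. \<D> i). open V \<and> closure V = UNIV"
      using Q unfolding Q_def by blast
    moreover have "open (\<Union>i. U i)" "countable (\<Union>i. \<D> i)"
      using Q unfolding Q_def by auto
    ultimately have "Q (\<Union>i. a i) (\<Union>i. U i) (\<Union>i. \<D> i)"
      unfolding Q_def by (intro conjI)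
    then show ?case by blast
  qed
  then show ?thesis unfolding Q_def .
qed

text \<open>Continuity need only be tested on a countable basis, so countably many preimages are
  replaced by open sets and all the exceptional dense open sets are intersected. One set serves
  every \<open>f n\<close>.\<close>

lemma borel_measurable_continuous_on_dense_Gdelta:
  fixes f :: "nat \<Rightarrow> 'a::topological_space \<Rightarrow> 'b::second_countable_topology"
  assumes "\<And>n. f n \<in> borel_measurable borel"
  obtains D :: "nat \<Rightarrow> 'a set" where "\<And>j. open (D j)" "\<And>j. closure (D j) = UNIV"
    "\<And>n. continuous_on (\<Inter>j. D j) (f n)"
proof -
  obtain \<B> :: "'b set set" where \<B>: "countable \<B>" "topological_basis \<B>"
    using ex_countable_basis by blast
  have "\<forall>n B. \<exists>U \<D>. B \<in> \<B> \<longrightarrow> open U \<and> countable \<D> \<and> (\<forall>V\<in>\<D>. open V \<and> closure V = UNIV) \<and>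
           (f n -` B) \<inter> \<Inter>\<D> = U \<inter> \<Inter>\<D>"
    using assms borel_open_modulo_dense \<B>
    by (metis borel_open measurable_sets_borel topological_basis_open)
  then obtain U \<D> where UD: "\<And>n B. B \<in> \<B> \<Longrightarrow> open (U n B)"
    "\<And>n B. B \<in> \<B> \<Longrightarrow> countable (\<D> n B)"
    "\<And>n B V. B \<in> \<B> \<Longrightarrow> V \<in> \<D> n B \<Longrightarrow> open V \<and> closure V = UNIV"
    "\<And>n B. B \<in> \<B> \<Longrightarrow> (f n -` B) \<inter> \<Inter>(\<D> n B) = U n B \<inter> \<Inter>(\<D> n B)"
    by metis
  \<comment> \<open>\<open>UNIV\<close> keeps the family nonempty, so that
    \<open>from_nat_into\<close> enumerates exactly its members.\<close>
  define \<E> where "\<E> = insert UNIV (\<Union>n. \<Union>B\<in>\<B>. \<D> n B)"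
  have \<E>: "countable \<E>" "\<E> \<noteq> {}" "\<And>V. V \<in> \<E> \<Longrightarrow> open V \<and> closure V = UNIV"
    unfolding \<E>_def using UD \<B>(1) by (auto 4 4)
  have range: "range (from_nat_into \<E>) = \<E>"
    using \<E> by (simp add: range_from_nat_into)
  show ?thesis
  proof
    show "open (from_nat_into \<E> j)" "closure (from_nat_into \<E> j) = UNIV" for j
      using \<E> from_nat_into[of \<E>] by auto
    show "continuous_on (\<Inter>j. from_nat_into \<E> j) (f n)" for n
      unfolding range continuous_on_open_invariant
    proof (intro allI impI)
      fix B :: "'b set" assume "open B"
      then obtain \<B>' where \<B>': "\<B>' \<subseteq> \<B>" "\<Union>\<B>' = B"
        using \<B>(2) by (auto simp: topological_basis_def)
      have "f n -` b \<inter> \<Inter>\<E> = U n b \<inter> \<Inter>\<E>" if "b \<in> \<B>" for b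
      proof -
        have "\<D> n b \<subseteq> \<E>" using that by (auto simp: \<E>_def)
        then show ?thesis using UD(4)[OF that, of n] by blast
      qed
      then have "(\<Union>b\<in>\<B>'. U n b) \<inter> \<Inter>\<E> = f n -` B \<inter> \<Inter>\<E>"
        using \<B>' by blast
      then show "\<exists>A. open A \<and> A \<inter> \<Inter>\<E> = f n -` B \<inter> \<Inter>\<E>"
        using UD(1) \<B>'(1) by (intro exI[of _ "\<Union>b\<in>\<B>'. U n b"] conjI open_UN ballI) auto
    qed
  qed
qed

lemma Baire_nat_seq:
  fixes \<G> :: "(nat \<Rightarrow> nat) set set"
  assumes "countable \<G>" "\<And>V. V \<in> \<G> \<Longrightarrow> open V \<and> closure V = UNIV"
  shows "closure (\<Inter>\<G>) = UNIV"
proof -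
  have eq: "(euclidean :: nat topology) = discrete_topology UNIV"
    by (simp add: topology_eq open_discrete)
  have "completely_metrizable_space (product_topology (\<lambda>_::nat. euclidean :: nat topology) UNIV)"
    using completely_metrizable_space_discrete_topology[of "UNIV :: nat set"]
    by (auto simp: completely_metrizable_space_product_topology eq)
  then have "completely_metrizable_space (euclidean :: (nat \<Rightarrow> nat) topology)"
    by (simp add: euclidean_product_topology)
  from Baire_category[OF disjI1[OF this] assms(1)] assms(2) show ?thesis
    by simp
qed

lemma open_range_conc: "open (range ((\<frown>) w) :: (nat \<Rightarrow> nat) set)"
proof -
  have "range ((\<frown>) w) = {z. \<forall>i\<in>{..<length w}. z i \<in> {w ! i}}"
  proof (intro equalityI subsetI)
    fix z assume "z \<in> {z. \<forall>i\<in>{..<length w}. z i \<in> {w ! i}}"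
    then have "z = w \<frown> (\<lambda>n. z (length w + n))"
      by (auto simp: fun_eq_iff conc_def)
    then show "z \<in> range ((\<frown>) w)" by blast
  qed auto
  then show ?thesis
    using product_topology_basis'[of "{..<length w}" "\<lambda>i. {w ! i}" "\<lambda>i. i"]
    by (simp add: open_discrete)
qed

lemma continuous_on_conc: "continuous_on A (\<lambda>z. w \<frown> z :: nat \<Rightarrow> nat)"
proof (rule continuous_on_coordinatewise_then_product)
  show "continuous_on A (\<lambda>x. (w \<frown> x) i)" for i
    by (cases "i < length w") (auto intro: continuous_on_subset[OF continuous_on_product_coordinates])
qed

lemma open_nat_seq_prefix:
  fixes V :: "(nat \<Rightarrow> nat) set"
  assumes "open V" "z \<in> V"
  shows "\<forall>\<^sub>F k in sequentially. \<forall>z'. Omega_Words_Fun.prefix k z \<frown> z' \<in> V"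
proof -
  obtain X where X: "z \<in> (\<Pi>\<^sub>E i\<in>UNIV. X i)" "finite {i. X i \<noteq> UNIV}" "(\<Pi>\<^sub>E i\<in>UNIV. X i) \<subseteq> V"
    using product_topology_open_contains_basis[of "\<lambda>_. euclidean" UNIV V z] assms
    by (auto simp: open_fun_def)
  obtain K where K: "\<And>i. X i \<noteq> UNIV \<Longrightarrow> i < K"
    using finite_nat_set_iff_bounded X(2) by auto
  have "Omega_Words_Fun.prefix k z \<frown> z' \<in> V" if "k \<ge> K" for k z'
  proof -
    have "(Omega_Words_Fun.prefix k z \<frown> z') i \<in> X i" for i
    proof (cases "X i = UNIV")
      case False
      then have "i < k" using K that by (meson order_less_le_trans)
      then show ?thesis using X(1) by auto
    qed auto
    then show ?thesis using X(3) by blast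
  qed
  then show ?thesis by (auto simp: eventually_sequentially)
qed

lemma dense_nat_seq_iff:
  fixes V :: "(nat \<Rightarrow> nat) set"
  shows "closure V = UNIV \<longleftrightarrow> (\<forall>w. range ((\<frown>) w) \<inter> V \<noteq> {})"
proof
  assume dense: "closure V = UNIV"
  show "\<forall>w. range ((\<frown>) w) \<inter> V \<noteq> {}"
  proof
    fix w
    show "range ((\<frown>) w) \<inter> V \<noteq> {}"
      using open_Int_closure_eq_empty[OF open_range_conc[of w], of V] dense by auto
  qed
next
  assume meets: "\<forall>w. range ((\<frown>) w) \<inter> V \<noteq> {}"
  have "z \<in> closure V" for z
    unfolding closure_iff_nhds_not_empty
  proof (intro allI impI)
    fix A U assume "U \<subseteq> A" "open U" "z \<in> U"
    then obtain k where "\<And>z'. Omega_Words_Fun.prefix k z \<frown> z' \<in> U"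
      using open_nat_seq_prefix[of U z] by (auto simp: eventually_sequentially)
    then show "V \<inter> A \<noteq> {}"
      using meets[rule_format, of "Omega_Words_Fun.prefix k z"] \<open>U \<subseteq> A\<close> by blast
  qed
  then show "closure V = UNIV" by blast
qed

text \<open>Continuations that start with \<open>u\<close> correspond to the cylinder of
  \<open>w @ u\<close>. So density can be demanded behind several prefixes at once, as
  \<open>filler_exists\<close> does.\<close>

lemma closure_vimage_conc:
  assumes "closure V = (UNIV :: (nat \<Rightarrow> nat) set)"
  shows "closure ((\<frown>) w -` V) = UNIV"
  unfolding dense_nat_seq_iff
proof
  fix u
  obtain z where "(w @ u) \<frown> z \<in> V"
    using assms[unfolded dense_nat_seq_iff, rule_format, of "w @ u"] by auto
  then have "u \<frown> z \<in> range ((\<frown>) u) \<inter> (\<frown>) w -` V" by simp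
  then show "range ((\<frown>) u) \<inter> (\<frown>) w -` V \<noteq> {}" by blast
qed

text \<open>By Baire category, a single word \<open>w\<close> can be inserted after all the finitely many prefixes in
  \<open>P\<close> such that beyond \<open>l\<close> the function value forgets the prefix (up to a constant), while
  below \<open>l\<close> it forgets whatever comes after \<open>w\<close>.\<close>

lemma filler_exists:
  fixes f :: "(nat \<Rightarrow> nat) \<Rightarrow> nat \<Rightarrow> real"
  assumes D: "\<And>j::nat. open (D j)" "\<And>j. closure (D j) = UNIV"
    and cont: "\<And>n. continuous_on (\<Inter>j. D j) (\<lambda>x. f x n)"
    and fin: "finite P"
    and conv: "\<And>s s' z. s \<in> P \<Longrightarrow> s' \<in> P \<Longrightarrow> convergent (\<lambda>n. f (s \<frown> z) n - f (s' \<frown> z) n)"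
    and e: "e > 0"
  shows "\<exists>w l. N \<le> l \<and> (\<forall>s\<in>P. \<forall>z. (s @ w) \<frown> z \<in> D j) \<and>
    (\<forall>z. (\<forall>s\<in>P. (s @ w) \<frown> z \<in> (\<Inter>j. D j)) \<longrightarrow>
      (\<forall>s\<in>P. \<forall>s'\<in>P. \<forall>m\<ge>l. \<forall>n\<ge>l.
        \<bar>(f ((s @ w) \<frown> z) m - f ((s' @ w) \<frown> z) m) - (f ((s @ w) \<frown> z) n - f ((s' @ w) \<frown> z) n)\<bar> \<le> e)) \<and>
    (\<forall>s\<in>P. \<forall>z z'. (s @ w) \<frown> z \<in> (\<Inter>j. D j) \<longrightarrow> (s @ w) \<frown> z' \<in> (\<Inter>j. D j) \<longrightarrow>
      (\<forall>m\<le>l. \<bar>f ((s @ w) \<frown> z) m - f ((s @ w) \<frown> z') m\<bar> \<le> e))"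
proof -
  define C where "C = (\<Inter>j. D j)"
  define \<G> where "\<G> = (\<lambda>(s, j). (\<frown>) s -` D j) ` (P \<times> UNIV)"
  define K where "K = \<Inter>\<G>"
  define g where "g s s' z m n = \<bar>(f (s \<frown> z) m - f (s' \<frown> z) m) - (f (s \<frown> z) n - f (s' \<frown> z) n)\<bar>"
    for s s' z m n
  \<comment> \<open>A continuation is bad at \<open>l\<close> if some difference still varies by
    more than \<open>e\<close> beyond \<open>l\<close>. The strict inequality makes this relatively
    open in \<open>K\<close>.\<close>
  define bad where "bad l = (\<Union>s\<in>P. \<Union>s'\<in>P. \<Union>m\<in>{l..}. \<Union>n\<in>{l..}. {z\<in>K. g s s' z m n > e})" for l
  have K_iff: "z \<in> K \<longleftrightarrow> (\<forall>s\<in>P. s \<frown> z \<in> C)" for z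
    by (auto simp: K_def \<G>_def C_def)
  have \<G>: "countable \<G>" "\<And>V. V \<in> \<G> \<Longrightarrow> open V \<and> closure V = UNIV"
    using fin D by (auto simp: \<G>_def countable_finite closure_vimage_conc continuous_on_conc open_vimage)
  have K_meets: "K \<inter> range ((\<frown>) w) \<noteq> {}" for w
    using Baire_nat_seq[OF \<G>] unfolding K_def dense_nat_seq_iff by blast
  have cont_conc: "continuous_on K (\<lambda>z. f (s \<frown> z) n)" if "s \<in> P" for s n
    by (rule continuous_on_compose2[OF cont[of n] continuous_on_conc])
       (use that in \<open>auto simp: K_iff C_def\<close>)
  have "openin (top_of_set K) {z\<in>K. g s s' z m n > e}" if "s \<in> P" "s' \<in> P" for s s' m n
  proof -
    have "continuous_on K (\<lambda>z. g s s' z m n)"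
      unfolding g_def using that by (intro continuous_intros cont_conc)
    then have "openin (top_of_set K) (K \<inter> (\<lambda>z. g s s' z m n) -` {e<..})"
      by (rule continuous_openin_preimage_gen) simp
    then show ?thesis by (simp add: vimage_def Int_def)
  qed
  then have "openin (top_of_set K) (bad l)" for l
    unfolding bad_def by (intro openin_Union ballI) (auto intro!: openin_Union)
  then obtain V where V: "\<And>l. open (V l)" "\<And>l. bad l = K \<inter> V l"
    unfolding openin_open by metis
  \<comment> \<open>Otherwise every \<open>V l\<close> with \<open>l \<ge> N\<close> is open and
    dense, and Baire yields one continuation that is bad at all these \<open>l\<close>. But for a
    fixed continuation the finitely many differences are Cauchy.\<close>
  have "\<exists>l\<ge>N. \<exists>w. K \<inter> range ((\<frown>) w) \<inter> bad l = {}"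
  proof (rule ccontr)
    assume "\<not> ?thesis"
    then have meets: "\<And>l w. l \<ge> N \<Longrightarrow> range ((\<frown>) w) \<inter> V l \<noteq> {}"
      using V(2) by blast
    have V_dense: "closure (V l) = UNIV" if "l \<ge> N" for l
      unfolding dense_nat_seq_iff using meets[OF that] by blast
    have "closure (\<Inter>(\<G> \<union> V ` {N..})) = UNIV"
    proof (rule Baire_nat_seq)
      show "countable (\<G> \<union> V ` {N..})" using \<G>(1) by simp
      show "open U \<and> closure U = UNIV" if "U \<in> \<G> \<union> V ` {N..}" for U
        using that \<G>(2) V(1) V_dense by blast
    qed
    then have "\<Inter>(\<G> \<union> V ` {N..}) \<noteq> {}"
      by force
    then obtain z where z: "z \<in> \<Inter>(\<G> \<union> V ` {N..})"
      by blast
    have zbad: "z \<in> bad l" if "l \<ge> N" for l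
      using z that unfolding V(2) K_def by blast
    have "\<forall>\<^sub>F l in sequentially. \<forall>m\<ge>l. \<forall>n\<ge>l. g s s' z m n \<le> e" if "s \<in> P" "s' \<in> P" for s s'
    proof -
      from conv[OF that, of z] have "Cauchy (\<lambda>n. f (s \<frown> z) n - f (s' \<frown> z) n)"
        by (simp add: Cauchy_convergent_iff)
      from CauchyD[OF this e] obtain M where "\<And>m n. m \<ge> M \<Longrightarrow> n \<ge> M \<Longrightarrow> g s s' z m n < e"
        unfolding g_def by (auto simp: real_norm_def)
      then show ?thesis unfolding eventually_sequentially
        by (meson order.trans less_imp_le)
    qed
    then have "\<forall>\<^sub>F l in sequentially. \<forall>s\<in>P. \<forall>s'\<in>P. \<forall>m\<ge>l. \<forall>n\<ge>l. g s s' z m n \<le> e"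
      using fin by (intro eventually_ball_finite ballI) auto
    from eventually_happens'[OF sequentially_bot eventually_conj[OF eventually_ge_at_top[of N] this]]
    obtain l where "l \<ge> N" and l: "\<And>s s' m n. \<lbrakk>s \<in> P; s' \<in> P; m \<ge> l; n \<ge> l\<rbrakk> \<Longrightarrow> g s s' z m n \<le> e"
      by blast
    from zbad[OF \<open>l \<ge> N\<close>] obtain s s' m n where "s \<in> P" "s' \<in> P" "m \<ge> l" "n \<ge> l" "g s s' z m n > e"
      unfolding bad_def by blast
    with l show False by (meson not_le)
  qed
  then obtain l w\<^sub>1 where l: "l \<ge> N" and w\<^sub>1: "K \<inter> range ((\<frown>) w\<^sub>1) \<inter> bad l = {}"
    by blast
  obtain z\<^sub>0 where z\<^sub>0: "z\<^sub>0 \<in> K" "z\<^sub>0 \<in> range ((\<frown>) w\<^sub>1)"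
    using K_meets by blast
  \<comment> \<open>The filler will be a long prefix of \<open>z\<^sub>0\<close>: each of the
    finitely many remaining demands holds for all sufficiently long prefixes. Values are compared
    with those at \<open>s \<frown> z\<^sub>0\<close>, at a cost of \<open>e / 2\<close> for each of
    two words.\<close>
  let ?p = "\<lambda>k. Omega_Words_Fun.prefix k z\<^sub>0"
  have "\<forall>\<^sub>F k in sequentially. \<forall>z. (s @ ?p k) \<frown> z \<in> D j" if "s \<in> P" for s
    using open_nat_seq_prefix[of "(\<frown>) s -` D j" z\<^sub>0] D z\<^sub>0 that
    by (auto simp: K_iff C_def continuous_on_conc open_vimage)
  then have ev1: "\<forall>\<^sub>F k in sequentially. \<forall>s\<in>P. \<forall>z. (s @ ?p k) \<frown> z \<in> D j"
    using fin by (intro eventually_ball_finite) auto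
  have "\<forall>\<^sub>F k in sequentially. \<forall>z. (s @ ?p k) \<frown> z \<in> C \<longrightarrow>
      \<bar>f ((s @ ?p k) \<frown> z) m - f (s \<frown> z\<^sub>0) m\<bar> \<le> e / 2" if "s \<in> P" for s m
  proof -
    have "s \<frown> z\<^sub>0 \<in> C" using z\<^sub>0 that by (auto simp: K_iff)
    moreover have "continuous_on C (\<lambda>x. f x m)" using cont by (simp add: C_def)
    ultimately obtain W where W: "open W" "s \<frown> z\<^sub>0 \<in> W"
      "\<And>x. x \<in> C \<Longrightarrow> x \<in> W \<Longrightarrow> f x m \<in> ball (f (s \<frown> z\<^sub>0) m) (e / 2)"
      unfolding continuous_on_topological using e
      by (metis open_ball centre_in_ball half_gt_zero)
    have "\<forall>\<^sub>F k in sequentially. \<forall>z. ?p k \<frown> z \<in> (\<frown>) s -` W"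
      using W by (intro open_nat_seq_prefix) (auto simp: continuous_on_conc open_vimage)
    then show ?thesis
    proof eventually_elim
      case (elim k)
      show ?case
      proof (intro allI impI)
        fix z assume z: "(s @ ?p k) \<frown> z \<in> C"
        have "(s @ ?p k) \<frown> z \<in> W" using elim by simp
        from W(3)[OF z this] show "\<bar>f ((s @ ?p k) \<frown> z) m - f (s \<frown> z\<^sub>0) m\<bar> \<le> e / 2"
          by (simp add: dist_real_def abs_minus_commute)
      qed
    qed
  qed
  then have ev2: "\<forall>\<^sub>F k in sequentially. \<forall>s\<in>P. \<forall>m\<in>{..l}. \<forall>z. (s @ ?p k) \<frown> z \<in> C \<longrightarrow>
      \<bar>f ((s @ ?p k) \<frown> z) m - f (s \<frown> z\<^sub>0) m\<bar> \<le> e / 2"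
    using fin by (intro eventually_ball_finite ballI) auto
  have "\<forall>\<^sub>F k in sequentially. \<forall>z. ?p k \<frown> z \<in> range ((\<frown>) w\<^sub>1)"
    using z\<^sub>0 by (intro open_nat_seq_prefix open_range_conc)
  from eventually_happens'[OF sequentially_bot eventually_conj[OF this eventually_conj[OF ev1 ev2]]]
  obtain k where
    k1: "\<And>z. ?p k \<frown> z \<in> range ((\<frown>) w\<^sub>1)" and k2: "\<And>s z. s \<in> P \<Longrightarrow> (s @ ?p k) \<frown> z \<in> D j"
    and k3: "\<And>s m z. s \<in> P \<Longrightarrow> m \<le> l \<Longrightarrow> (s @ ?p k) \<frown> z \<in> C \<Longrightarrow>
      \<bar>f ((s @ ?p k) \<frown> z) m - f (s \<frown> z\<^sub>0) m\<bar> \<le> e / 2"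
    by blast
  have "g (s @ ?p k) (s' @ ?p k) z m n \<le> e"
    if "\<forall>s\<in>P. (s @ ?p k) \<frown> z \<in> C" "s \<in> P" "s' \<in> P" "m \<ge> l" "n \<ge> l" for s s' z m n
  proof -
    have "?p k \<frown> z \<in> K" using that by (auto simp: K_iff)
    then have "?p k \<frown> z \<notin> bad l" using k1[of z] w\<^sub>1 by blast
    then have "\<not> g s s' (?p k \<frown> z) m n > e" using that(2-) \<open>?p k \<frown> z \<in> K\<close> unfolding bad_def by blast
    then show ?thesis by (simp add: g_def)
  qed
  note osc = this
  have small: "\<bar>f ((s @ ?p k) \<frown> z) m - f ((s @ ?p k) \<frown> z') m\<bar> \<le> e"
    if "s \<in> P" "(s @ ?p k) \<frown> z \<in> C" "(s @ ?p k) \<frown> z' \<in> C" "m \<le> l" for s z z' m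
    using k3[OF that(1,4,2)] k3[OF that(1,4,3)] by linarith
  show ?thesis
    unfolding C_def[symmetric]
  proof (intro exI conjI allI impI ballI)
    show "N \<le> l" by (rule l)
    show "(s @ ?p k) \<frown> z \<in> D j" if "s \<in> P" for s z by (rule k2[OF that])
    show "\<bar>f ((s @ ?p k) \<frown> z) m - f ((s' @ ?p k) \<frown> z) m -
        (f ((s @ ?p k) \<frown> z) n - f ((s' @ ?p k) \<frown> z) n)\<bar> \<le> e"
      if "\<forall>s\<in>P. (s @ ?p k) \<frown> z \<in> C" "s \<in> P" "s' \<in> P" "l \<le> m" "l \<le> n" for s s' z m n
      using osc[OF that] unfolding g_def .
    show "\<bar>f ((s @ ?p k) \<frown> z) m - f ((s @ ?p k) \<frown> z') m\<bar> \<le> e"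
      if "s \<in> P" "(s @ ?p k) \<frown> z \<in> C" "(s @ ?p k) \<frown> z' \<in> C" "m \<le> l" for s z z' m
      by (rule small[OF that])
  qed
qed

section \<open>Block words\<close>

primrec block_prefix :: "(nat \<Rightarrow> nat list) \<Rightarrow> (nat \<Rightarrow> nat) \<Rightarrow> nat set \<Rightarrow> nat \<Rightarrow> nat list" where
  "block_prefix w v B 0 = []"
| "block_prefix w v B (Suc j) = block_prefix w v B j @ w j @ [if j \<in> B then v j else 0]"

text \<open>Every block has at least one letter, so position \<open>n\<close> is settled after
  \<open>Suc n\<close> blocks.\<close>

definition block_word :: "(nat \<Rightarrow> nat list) \<Rightarrow> (nat \<Rightarrow> nat) \<Rightarrow> nat set \<Rightarrow> nat \<Rightarrow> nat" where
  "block_word w v B = (\<lambda>n. block_prefix w v B (Suc n) ! n)"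

lemma length_block_prefix_ge: "j \<le> length (block_prefix w v B j)"
  by (induction j) auto

lemma length_block_prefix_eq: "length (block_prefix w v B j) = length (block_prefix w v B' j)"
  by (induction j) auto

lemma block_prefix_cong:
  assumes "\<And>i. i < j \<Longrightarrow> i \<in> B \<longleftrightarrow> i \<in> B'"
  shows "block_prefix w v B j = block_prefix w v B' j"
  using assms by (induction j) auto

lemma block_prefix_append:
  assumes "j \<le> k" "\<And>i. i \<ge> j \<Longrightarrow> i \<in> B \<longleftrightarrow> i \<in> B'"
  shows "\<exists>t. block_prefix w v B k = block_prefix w v B j @ t \<and>
             block_prefix w v B' k = block_prefix w v B' j @ t"
  using assms(1)
proof (induction k rule: dec_induct)
  case (step n)
  then show ?case using assms(2)[of n] by auto
qed simp

lemma block_word_nth: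
  assumes "n < length (block_prefix w v B j)"
  shows "block_word w v B n = block_prefix w v B j ! n"
proof (cases "j \<le> Suc n")
  case True
  then obtain t where "block_prefix w v B (Suc n) = block_prefix w v B j @ t"
    using block_prefix_append[of j "Suc n" B B] by blast
  then show ?thesis using assms unfolding block_word_def by (simp only: nth_append if_True)
next
  case False
  then obtain t where "block_prefix w v B j = block_prefix w v B (Suc n) @ t"
    using block_prefix_append[of "Suc n" j B B w v] by auto
  moreover have "n < length (block_prefix w v B (Suc n))"
    using length_block_prefix_ge[of "Suc n" w v B] by linarith
  ultimately show ?thesis unfolding block_word_def by (simp only: nth_append if_True)
qed

text \<open>This is the form \<open>(s @ w) \<frown> z\<close>, with a common \<open>z\<close>,
  about which \<open>filler_exists\<close> speaks. The letter at site \<open>j\<close> belongs to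
  \<open>z\<close>.\<close>

lemma block_word_split:
  assumes "\<And>i. i \<ge> j \<Longrightarrow> i \<in> B \<longleftrightarrow> i \<in> B'"
  obtains z where "block_word w v B = (block_prefix w v B j @ w j) \<frown> z"
    "block_word w v B' = (block_prefix w v B' j @ w j) \<frown> z"
proof -
  define k where "k = length (block_prefix w v B j @ w j)"
  have k': "k = length (block_prefix w v B' j @ w j)"
    unfolding k_def using length_block_prefix_eq[of w v B j B'] by simp
  have split: "block_word w v C = (block_prefix w v C j @ w j) \<frown> (\<lambda>n. block_word w v C (n + k))"
    if "k = length (block_prefix w v C j @ w j)" for C
  proof
    fix n
    show "block_word w v C n = ((block_prefix w v C j @ w j) \<frown> (\<lambda>n. block_word w v C (n + k))) n"
    proof (cases "n < k")
      case True
      have "block_word w v C n = block_prefix w v C (Suc j) ! n"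
        by (rule block_word_nth) (use True that in auto)
      also have "\<dots> = (block_prefix w v C j @ w j) ! n"
        using True that by (auto simp: nth_append)
      finally show ?thesis using True that by simp
    next
      case False
      then show ?thesis using that by (simp add: conc_def)
    qed
  qed
  have "block_word w v B (n + k) = block_word w v B' (n + k)" for n
  proof -
    define i where "i = Suc (max j (n + k))"
    have i: "j \<le> i" "n + k < i" unfolding i_def by auto
    obtain t where t: "block_prefix w v B i = block_prefix w v B j @ t"
      "block_prefix w v B' i = block_prefix w v B' j @ t"
      using block_prefix_append[OF i(1) assms] by blast
    have "n + k < length (block_prefix w v C i)" for C
      using length_block_prefix_ge[of i w v C] i by linarith
    then have "block_word w v C (n + k) = block_prefix w v C i ! (n + k)" for C
      by (rule block_word_nth)
    moreover have "length (block_prefix w v B j) \<le> n + k" "length (block_prefix w v B' j) \<le> n + k"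
      using k' k_def by auto
    ultimately show ?thesis
      using length_block_prefix_eq[of w v B j B'] by (simp add: nth_append t)
  qed
  then have tails: "(\<lambda>n. block_word w v B (n + k)) = (\<lambda>n. block_word w v B' (n + k))"
    by (rule ext)
  show ?thesis
    using that[OF split[OF k_def]] split[OF k'] unfolding tails by blast
qed

text \<open>Consecutive blocks share an endpoint, so their bounds chain up to a geometric tail,
  which makes \<open>g\<close> Cauchy.\<close>

lemma convergent_if_geometric_on_blocks:
  fixes g :: "nat \<Rightarrow> real"
  assumes l: "strict_mono l"
    and g: "\<And>j m n. \<lbrakk>l j \<le> m; m \<le> l (Suc j); l j \<le> n; n \<le> l (Suc j)\<rbrakk> \<Longrightarrow> \<bar>g m - g n\<bar> \<le> c * (1/2) ^ j"
  shows "convergent g"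
proof -
  have mono: "l i \<le> l j" if "i \<le> j" for i j
    using l that by (simp add: strict_mono_less_eq)
  have c: "c \<ge> 0"
    using g[of 0 "l 0" "l 0"] mono[of 0 1] by simp
  \<comment> \<open>The right-hand side is the sum of \<open>c * (1/2) ^ i\<close> over
    \<open>j \<le> i < k\<close>.\<close>
  have ends: "\<bar>g (l k) - g (l j)\<bar> \<le> 2 * c * ((1/2) ^ j - (1/2) ^ k)" if "j \<le> k" for j k
    using that
  proof (induction k rule: dec_induct)
    case (step n)
    have "\<bar>g (l (Suc n)) - g (l n)\<bar> \<le> c * (1/2) ^ n"
      using mono[of n "Suc n"] by (intro g) auto
    then show ?case using step.IH by (simp add: algebra_simps)
  qed simp
  have near: "\<bar>g n - g (l j)\<bar> \<le> 2 * c * (1/2) ^ j" if n: "n \<ge> l j" for j n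
  proof -
    have "\<exists>k\<ge>j. l k \<le> n \<and> n \<le> l (Suc k)" if "n \<le> l i" for i
      using that
    proof (induction i)
      case 0
      then show ?case using n mono[of 0 j] mono[of j "Suc j"] by (intro exI[of _ j]) auto
    next
      case (Suc i)
      show ?case
      proof (cases "n \<le> l i")
        case False
        show ?thesis
        proof (cases "i \<ge> j")
          case True
          then show ?thesis using False Suc.prems by auto
        next
          case F: False
          then have "Suc i \<le> j" by simp
          then have "n = l j" using mono[of "Suc i" j] Suc.prems n by simp
          then show ?thesis using mono[of j "Suc j"] by (intro exI[of _ j]) auto
        qed
      qed (use Suc.IH in blast)
    qed
    from this[of n] obtain k where k: "k \<ge> j" "l k \<le> n" "n \<le> l (Suc k)"
      using strict_mono_imp_increasing[OF l, of n] by blast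
    have "\<bar>g n - g (l k)\<bar> \<le> c * (1/2) ^ k"
      using k mono[of k "Suc k"] by (intro g) auto
    moreover have "c * (1/2) ^ k \<le> 2 * c * (1/2) ^ k" using c by simp
    ultimately show ?thesis
      using ends[OF k(1)] by (simp add: algebra_simps)
  qed
  have "Cauchy g"
  proof (rule CauchyI)
    fix e :: real assume e: "e > 0"
    have "(\<lambda>j. 4 * c * (1/2) ^ j) \<longlonglongrightarrow> 4 * c * 0"
      by (intro tendsto_intros LIMSEQ_power_zero) auto
    then have "\<forall>\<^sub>F j in sequentially. 4 * c * (1/2) ^ j < e"
      using e by (auto dest: order_tendstoD(2))
    then obtain j where j: "4 * c * (1/2) ^ j < e"
      using eventually_happens'[OF sequentially_bot] by blast
    have "norm (g m - g n) < e" if "m \<ge> l j" "n \<ge> l j" for m n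
      using near[OF that(1)] near[OF that(2)] j by (auto simp: real_norm_def abs_le_iff abs_less_iff)
    then show "\<exists>M. \<forall>m\<ge>M. \<forall>n\<ge>M. norm (g m - g n) < e" by blast
  qed
  then show ?thesis by (simp add: Cauchy_convergent_iff)
qed

text \<open>Between \<open>l j\<close> and \<open>l (Suc j)\<close> the increments of \<open>f (block_word w v B)\<close> depend, up to
  \<open>2 / 2 ^ j\<close>, only on whether \<open>j \<in> B\<close>.\<close>

lemma block_words_four_cycle:
  fixes f :: "(nat \<Rightarrow> nat) \<Rightarrow> nat \<Rightarrow> real" and v :: "nat \<Rightarrow> nat"
  assumes borel: "\<And>n. (\<lambda>x. f x n) \<in> borel_measurable borel"
    and conv: "\<And>s s' z. length s = length s' \<Longrightarrow> convergent (\<lambda>n. f (s \<frown> z) n - f (s' \<frown> z) n)"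
  shows "\<exists>w. \<forall>B\<^sub>1 B\<^sub>2 B\<^sub>3 B\<^sub>4.
    (\<forall>j. (j \<in> B\<^sub>1 \<longleftrightarrow> j \<in> B\<^sub>3) \<and> (j \<in> B\<^sub>2 \<longleftrightarrow> j \<in> B\<^sub>4) \<or> (j \<in> B\<^sub>1 \<longleftrightarrow> j \<in> B\<^sub>2) \<and> (j \<in> B\<^sub>3 \<longleftrightarrow> j \<in> B\<^sub>4)) \<longrightarrow>
    convergent (\<lambda>n. f (block_word w v B\<^sub>1) n - f (block_word w v B\<^sub>2) n
                  - f (block_word w v B\<^sub>3) n + f (block_word w v B\<^sub>4) n)"
proof -
  obtain D :: "nat \<Rightarrow> (nat \<Rightarrow> nat) set" where D: "\<And>j. open (D j)" "\<And>j. closure (D j) = UNIV"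
    "\<And>n. continuous_on (\<Inter>j. D j) (\<lambda>x. f x n)"
    using borel_measurable_continuous_on_dense_Gdelta[of "\<lambda>n x. f x n"] borel by blast
  define C where "C = (\<Inter>j. D j)"
  define osc where "osc P w l e \<longleftrightarrow> (\<forall>z. (\<forall>s\<in>P. (s @ w) \<frown> z \<in> C) \<longrightarrow>
      (\<forall>s\<in>P. \<forall>s'\<in>P. \<forall>m\<ge>l. \<forall>n\<ge>l.
        \<bar>(f ((s @ w) \<frown> z) m - f ((s' @ w) \<frown> z) m) - (f ((s @ w) \<frown> z) n - f ((s' @ w) \<frown> z) n)\<bar> \<le> e))"
    for P :: "nat list set" and w and l :: nat and e
  define near where "near P w l e \<longleftrightarrow> (\<forall>s\<in>P. \<forall>z z'. (s @ w) \<frown> z \<in> C \<longrightarrow> (s @ w) \<frown> z' \<in> C \<longrightarrow>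
      (\<forall>m\<le>l. \<bar>f ((s @ w) \<frown> z) m - f ((s @ w) \<frown> z') m\<bar> \<le> e))"
    for P :: "nat list set" and w and l :: nat and e
  \<comment> \<open>A state holds the possible prefixes before filler \<open>j\<close>, this filler,
    and the threshold \<open>l\<close>. The prefixes have equal length so that \<open>conv\<close>
    applies to any two of them.\<close>
  define good where "good j = (\<lambda>(P, w, l). finite P \<and> (\<exists>k. \<forall>s\<in>P. length s = k) \<and>
      (j = 0 \<longrightarrow> P = {[]}) \<and> (\<forall>s\<in>P. \<forall>z. (s @ w) \<frown> z \<in> D j) \<and>
      osc P w l ((1/2) ^ j) \<and> near P w l ((1/2) ^ j))" for j :: nat
  define succ where "succ j p q \<longleftrightarrow> snd (snd p) < snd (snd q) \<and>
      fst q = (\<lambda>(s, x). s @ fst (snd p) @ [x]) ` (fst p \<times> {0, v j})"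
    for j :: nat and p q :: "nat list set \<times> nat list \<times> nat"
  have ex: "\<exists>w l. N \<le> l \<and> (\<forall>s\<in>P. \<forall>z. (s @ w) \<frown> z \<in> D j) \<and> osc P w l e \<and> near P w l e"
    if "finite P" "\<exists>k. \<forall>s\<in>P. length s = k" "e > 0" for P N j e
    unfolding osc_def near_def C_def
    by (rule filler_exists[OF D that(1) conv that(3)]) (use that(2) in metis)
  \<comment> \<open>The prefixes that a filler has to serve contain all earlier fillers, hence
    dependent choice.\<close>
  have "\<exists>F. \<forall>j. good j (F j) \<and> succ j (F j) (F (Suc j))"
  proof (rule dependent_nat_choice)
    obtain w l where "\<forall>s\<in>{[]}. \<forall>z. (s @ w) \<frown> z \<in> D 0" "osc {[]} w l 1" "near {[]} w l 1"
      using ex[of "{[]}" 1 0 0] by auto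
    then have "good 0 ({[]}, w, l)" by (simp add: good_def)
    then show "\<exists>x. good 0 x" by blast
  next
    fix p j assume "good j p"
    obtain P w l where p: "p = (P, w, l)" by (cases p)
    let ?P = "(\<lambda>(s, x). s @ w @ [x]) ` (P \<times> {0, v j})"
    have P: "finite P" "\<exists>k. \<forall>s\<in>P. length s = k"
      using \<open>good j p\<close> unfolding p good_def prod.case by blast+
    then obtain k where k: "\<forall>s\<in>P. length s = k" by blast
    have P': "finite ?P" using P(1) by simp
    have len: "\<exists>k. \<forall>s\<in>?P. length s = k"
      using k by (intro exI[of _ "k + length w + 1"]) auto
    have "(1/2 :: real) ^ Suc j > 0" by simp
    from ex[OF P' len this, of "Suc l" "Suc j"] obtain w' l' where "Suc l \<le> l'" "\<forall>s\<in>?P. \<forall>z. (s @ w') \<frown> z \<in> D (Suc j)"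
      "osc ?P w' l' ((1/2) ^ Suc j)" "near ?P w' l' ((1/2) ^ Suc j)"
      by blast
    then have "good (Suc j) (?P, w', l') \<and> succ j p (?P, w', l')"
      using P' len unfolding good_def succ_def p prod.case fst_conv snd_conv
      by (intro conjI) (assumption | simp)+
    then show "\<exists>q. good (Suc j) q \<and> succ j p q" by blast
  qed
  then obtain F where F: "\<And>j. good j (F j)" "\<And>j. succ j (F j) (F (Suc j))" by blast
  define P where "P j = fst (F j)" for j
  define w where "w j = fst (snd (F j))" for j
  define l where "l j = snd (snd (F j))" for j
  have F_eq: "F j = (P j, w j, l j)" for j by (simp add: P_def w_def l_def)
  have good: "P 0 = {[]}" "\<And>j s z. s \<in> P j \<Longrightarrow> (s @ w j) \<frown> z \<in> D j"
    "\<And>j. osc (P j) (w j) (l j) ((1/2) ^ j)" "\<And>j. near (P j) (w j) (l j) ((1/2) ^ j)"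
    using F(1) unfolding F_eq good_def prod.case by blast+
  have l: "strict_mono l" and P_Suc: "\<And>j. P (Suc j) = (\<lambda>(s, x). s @ w j @ [x]) ` (P j \<times> {0, v j})"
    using F(2) unfolding succ_def P_def w_def l_def by (auto simp: strict_mono_Suc_iff)
  have P_eq: "P j = range (\<lambda>B. block_prefix w v B j)" for j
  proof (induction j)
    case 0
    then show ?case using good(1) by auto
  next
    case (Suc j)
    show ?case
    proof (intro equalityI subsetI)
      fix t assume "t \<in> P (Suc j)"
      then obtain B x where t: "t = block_prefix w v B j @ w j @ [x]" "x = 0 \<or> x = v j"
        unfolding P_Suc Suc.IH by auto
      define B' where "B' = {i. i < j \<and> i \<in> B \<or> i = j \<and> x = v j}"
      have "block_prefix w v B' j = block_prefix w v B j"
        by (rule block_prefix_cong) (auto simp: B'_def)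
      then have "t = block_prefix w v B' (Suc j)"
        using t by (auto simp: B'_def)
      then show "t \<in> range (\<lambda>B. block_prefix w v B (Suc j))" by blast
    next
      fix t assume "t \<in> range (\<lambda>B. block_prefix w v B (Suc j))"
      then obtain B where "t = block_prefix w v B (Suc j)" by blast
      then show "t \<in> P (Suc j)" unfolding P_Suc Suc.IH
        by (intro image_eqI[of _ _ "(block_prefix w v B j, if j \<in> B then v j else 0)"]) auto
    qed
  qed
  let ?x = "block_word w v"
  \<comment> \<open>Filler \<open>j\<close> forces every continuation into \<open>D j\<close>, so
    the infinite word lies in all of these sets.\<close>
  have in_C: "?x B \<in> C" for B
    unfolding C_def
  proof
    fix j
    obtain z where "?x B = (block_prefix w v B j @ w j) \<frown> z"
      using block_word_split[of j B B w v] by blast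
    then show "?x B \<in> D j" using good(2) P_eq by auto
  qed
  have low: "\<bar>f (?x B) m - f (?x B') m\<bar> \<le> (1/2) ^ j"
    if "\<And>i. i < j \<Longrightarrow> i \<in> B \<longleftrightarrow> i \<in> B'" "m \<le> l j" for B B' j m
  proof -
    have eq: "block_prefix w v B j = block_prefix w v B' j"
      using that(1) by (rule block_prefix_cong)
    obtain z where z: "?x B = (block_prefix w v B j @ w j) \<frown> z"
      using block_word_split[of j B B w v] by blast
    obtain z' where z': "?x B' = (block_prefix w v B j @ w j) \<frown> z'"
      using block_word_split[of j B' B' w v] eq by metis
    have "block_prefix w v B j \<in> P j" using P_eq by blast
    then show ?thesis
      using good(4)[of j] in_C[of B] in_C[of B'] that(2) unfolding near_def z z' by blast
  qed
  have high: "\<bar>(f (?x B) m - f (?x B') m) - (f (?x B) n - f (?x B') n)\<bar> \<le> (1/2) ^ j"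
    if agree: "\<And>i. i \<ge> j \<Longrightarrow> i \<in> B \<longleftrightarrow> i \<in> B'" and mn: "m \<ge> l j" "n \<ge> l j" for B B' j m n
  proof -
    obtain z where z: "?x B = (block_prefix w v B j @ w j) \<frown> z"
      "?x B' = (block_prefix w v B' j @ w j) \<frown> z"
      using block_word_split[of j B B' w v] agree by blast
    \<comment> \<open>\<open>osc\<close> asks that all prefixes in \<open>P j\<close>, not only the
      two compared, stay in \<open>C\<close> when followed by \<open>z\<close>. Each such word is
      itself a block word, with choice \<open>A'\<close>.\<close>
    have "(s @ w j) \<frown> z \<in> C" if sP: "s \<in> P j" for s
    proof -
      obtain A where s: "s = block_prefix w v A j" using sP unfolding P_eq by blast
      define A' where "A' = {i. i < j \<and> i \<in> A \<or> i \<ge> j \<and> i \<in> B}"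
      have "block_prefix w v A' j = s"
        unfolding s by (rule block_prefix_cong) (auto simp: A'_def)
      moreover obtain y where y: "?x A' = (block_prefix w v A' j @ w j) \<frown> y"
        "?x B = (block_prefix w v B j @ w j) \<frown> y"
        using block_word_split[of j A' B w v] by (auto simp: A'_def)
      moreover have "y = z" using y(2) z(1) by simp
      ultimately show ?thesis using in_C[of A'] by simp
    qed
    moreover have "block_prefix w v B j \<in> P j" "block_prefix w v B' j \<in> P j" using P_eq by blast+
    ultimately show ?thesis using good(3)[of j] mn unfolding osc_def z by blast
  qed
  have block: "\<bar>(f (?x B) m - f (?x B') m) - (f (?x B) n - f (?x B') n)\<bar> \<le> 2 * (1/2) ^ j"
    if "j \<in> B \<longleftrightarrow> j \<in> B'" "l j \<le> m" "m \<le> l (Suc j)" "l j \<le> n" "n \<le> l (Suc j)" for B B' j m n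
  proof -
    \<comment> \<open>The hybrid \<open>A\<close> follows \<open>B\<close> up to \<open>j\<close>
      and \<open>B'\<close> afterwards. \<open>low\<close> at \<open>Suc j\<close> compares it with
      \<open>B\<close>, and \<open>high\<close> at \<open>j\<close> compares it with
      \<open>B'\<close>, as these agree at \<open>j\<close>. The errors add up to
      \<open>2 * (1/2) ^ Suc j + (1/2) ^ j\<close>.\<close>
    define A where "A = {i. i \<le> j \<and> i \<in> B \<or> i > j \<and> i \<in> B'}"
    have "\<bar>f (?x B) m - f (?x A) m\<bar> \<le> (1/2) ^ Suc j" "\<bar>f (?x B) n - f (?x A) n\<bar> \<le> (1/2) ^ Suc j"
      using that by (intro low; auto simp: A_def)+
    moreover have "\<bar>(f (?x A) m - f (?x B') m) - (f (?x A) n - f (?x B') n)\<bar> \<le> (1/2) ^ j"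
      using that by (intro high) (auto simp: A_def le_less)
    ultimately show ?thesis unfolding power_Suc by linarith
  qed
  show ?thesis
  proof (intro exI allI impI)
    fix B\<^sub>1 B\<^sub>2 B\<^sub>3 B\<^sub>4 :: "nat set"
    assume agree: "\<forall>j. (j \<in> B\<^sub>1 \<longleftrightarrow> j \<in> B\<^sub>3) \<and> (j \<in> B\<^sub>2 \<longleftrightarrow> j \<in> B\<^sub>4) \<or>
                       (j \<in> B\<^sub>1 \<longleftrightarrow> j \<in> B\<^sub>2) \<and> (j \<in> B\<^sub>3 \<longleftrightarrow> j \<in> B\<^sub>4)"
    let ?g = "\<lambda>n. f (?x B\<^sub>1) n - f (?x B\<^sub>2) n - f (?x B\<^sub>3) n + f (?x B\<^sub>4) n"
    \<comment> \<open>At each \<open>j\<close> the alternating sum splits into two differences of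
      words that agree at \<open>j\<close>, paired as 1 with 3 and 2 with 4, or as 1 with 2 and 3
      with 4. Each pair contributes at most \<open>2 * (1/2) ^ j\<close>.\<close>
    have "\<bar>?g m - ?g n\<bar> \<le> 4 * (1/2) ^ j"
      if mn: "l j \<le> m" "m \<le> l (Suc j)" "l j \<le> n" "n \<le> l (Suc j)" for j m n
      using agree[rule_format, of j]
    proof (elim disjE conjE)
      assume "j \<in> B\<^sub>1 \<longleftrightarrow> j \<in> B\<^sub>3" "j \<in> B\<^sub>2 \<longleftrightarrow> j \<in> B\<^sub>4"
      from block[OF this(1) mn] block[OF this(2) mn] show ?thesis by linarith
    next
      assume "j \<in> B\<^sub>1 \<longleftrightarrow> j \<in> B\<^sub>2" "j \<in> B\<^sub>3 \<longleftrightarrow> j \<in> B\<^sub>4"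
      from block[OF this(1) mn] block[OF this(2) mn] show ?thesis by linarith
    qed
    then show "convergent ?g" by (rule convergent_if_geometric_on_blocks[OF l])
  qed
qed

section \<open>The relations of the two model groups\<close>

lemma space_borel_of [simp]: "space (borel_of X) = topspace X"
  by (simp add: borel_of_def space_measure_of_conv)

lemma sets_borel_of: "sets (borel_of X) = sigma_sets (topspace X) {U. openin X U}"
  unfolding borel_of_def by (rule sets_measure_of) (auto dest: openin_subset)

lemma borel_of_euclidean: "borel_of euclidean = borel"
  by (simp add: borel_of_def borel_def)

lemma continuous_map_measurable_borel_of:
  assumes "continuous_map X Y f"
  shows "f \<in> borel_of X \<rightarrow>\<^sub>M borel_of Y"
proof (rule measurable_sigma_sets[OF sets_borel_of])
  show "{U. openin Y U} \<subseteq> Pow (topspace Y)" by (auto dest: openin_subset)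
  show "f \<in> space (borel_of X) \<rightarrow> topspace Y"
    using assms by (auto simp: continuous_map_def)
  fix V assume "V \<in> {U. openin Y U}"
  then have "openin X (f -` V \<inter> topspace X)"
    using assms by (simp add: continuous_map_def vimage_def Int_def conj_commute)
  then show "f -` V \<inter> space (borel_of X) \<in> sets (borel_of X)"
    by (auto simp: sets_borel_of)
qed

lemma borel_reducible_continuous_map:
  assumes "continuous_map X Y f"
    and "\<And>x y. x \<in> topspace X \<Longrightarrow> y \<in> topspace X \<Longrightarrow> (x, y) \<in> E \<longleftrightarrow> (f x, f y) \<in> F"
  shows "borel_reducible X E Y F"
  using assms continuous_map_measurable_borel_of unfolding borel_reducible_def by blast

lemma borel_reducible_trans:
  assumes "borel_reducible X E Y F" "borel_reducible Y F Z H"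
  shows "borel_reducible X E Z H"
proof -
  obtain f g where fg: "f \<in> borel_of X \<rightarrow>\<^sub>M borel_of Y" "g \<in> borel_of Y \<rightarrow>\<^sub>M borel_of Z"
    "\<forall>x\<in>topspace X. \<forall>y\<in>topspace X. (x, y) \<in> E \<longleftrightarrow> (f x, f y) \<in> F"
    "\<forall>x\<in>topspace Y. \<forall>y\<in>topspace Y. (x, y) \<in> F \<longleftrightarrow> (g x, g y) \<in> H"
    using assms unfolding borel_reducible_def by blast
  have "f x \<in> topspace Y" if "x \<in> topspace X" for x
    using measurable_space[OF fg(1)] that by simp
  then show ?thesis
    unfolding borel_reducible_def using fg measurable_comp[OF fg(1,2)]
    by (intro bexI[of _ "g \<circ> f"]) auto
qed

lemma group_real_group: "group real_group"
  by (rule groupI) (auto simp: real_group_def intro: exI[of _ "- x" for x])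

lemma inv_real_group: "inv\<^bsub>real_group\<^esub> x = - x"
  by (rule group.inv_equality[OF group_real_group]) (auto simp: real_group_def)

lemma E_rel_real_group: "(x, y) \<in> E_rel real_group euclideanreal \<longleftrightarrow> convergent (\<lambda>n. x n - y n)"
  by (simp add: E_rel_def inv_real_group convergent_def) (simp add: real_group_def)

lemma group_Z2_ltimes_R: "group Z2_ltimes_R"
proof (rule groupI)
  fix x assume "x \<in> carrier Z2_ltimes_R"
  then show "\<exists>y\<in>carrier Z2_ltimes_R. y \<otimes>\<^bsub>Z2_ltimes_R\<^esub> x = \<one>\<^bsub>Z2_ltimes_R\<^esub>"
    by (intro bexI[of _ "(fst x, - ((-1) ^ fst x * snd x))"]) (auto simp: Z2_ltimes_R_def)
qed (auto simp: Z2_ltimes_R_def)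

lemma mult_Z2_ltimes_R:
  "(a, s) \<otimes>\<^bsub>Z2_ltimes_R\<^esub> (b, t) = ((a + b) mod 2, s + (-1) ^ a * t)"
  by (simp add: Z2_ltimes_R_def)

lemma inv_Z2_ltimes_R:
  "a \<in> {0, 1} \<Longrightarrow> inv\<^bsub>Z2_ltimes_R\<^esub> (a, s) = (a, - ((-1) ^ a * s))"
  by (rule group.inv_equality[OF group_Z2_ltimes_R]) (auto simp: Z2_ltimes_R_def)

lemma limitin_discrete_topology:
  "limitin (discrete_topology U) f l F \<longleftrightarrow> l \<in> U \<and> (\<forall>\<^sub>F x in F. f x = l)"
proof
  assume lim: "limitin (discrete_topology U) f l F"
  then have "l \<in> U" by (simp add: limitin_def)
  then show "l \<in> U \<and> (\<forall>\<^sub>F x in F. f x = l)"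
    using lim unfolding limitin_def by (metis (mono_tags, lifting) empty_subsetI eventually_mono
      insert_subset openin_discrete_topology singletonD singletonI)
next
  assume "l \<in> U \<and> (\<forall>\<^sub>F x in F. f x = l)"
  then show "limitin (discrete_topology U) f l F"
    unfolding limitin_def by (auto elim: eventually_mono)
qed

text \<open>The quotient of \<open>(a, s)\<close> by \<open>(b, t)\<close> is
  \<open>((a + b) mod 2, s - (-1) ^ (a + b) * t)\<close>. Its first coordinate is discrete, so the
  product of the signs must become a constant \<open>c\<close>, which then multiplies
  \<open>t\<close>.\<close>

lemma E_rel_Z2_ltimes_R:
  fixes x y :: "nat \<Rightarrow> nat \<times> real"
  assumes x: "\<And>n. fst (x n) \<in> {0, 1}" and y: "\<And>n. fst (y n) \<in> {0, 1}"
  shows "(x, y) \<in> E_rel Z2_ltimes_R Z2_ltimes_R_topology \<longleftrightarrow>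
    (\<exists>c. (\<forall>\<^sub>F n in sequentially. (-1) ^ fst (x n) * (-1) ^ fst (y n) = (c::real)) \<and>
         convergent (\<lambda>n. snd (x n) - c * snd (y n)))"
proof -
  define q where "q n = (-1 :: real) ^ fst (x n) * (-1) ^ fst (y n)" for n
  define z where "z n = x n \<otimes>\<^bsub>Z2_ltimes_R\<^esub> inv\<^bsub>Z2_ltimes_R\<^esub> (y n)" for n
  have z: "fst (z n) = (if q n = 1 then 0 else 1) \<and> snd (z n) = snd (x n) - q n * snd (y n) \<and>
      (q n = 1 \<or> q n = - 1)" for n
    unfolding z_def q_def using x[of n] y[of n]
    by (cases "x n"; cases "y n") (auto simp: inv_Z2_ltimes_R mult_Z2_ltimes_R)
  have carrier: "x n \<in> carrier Z2_ltimes_R" "y n \<in> carrier Z2_ltimes_R" for n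
    using x[of n] y[of n] by (cases "x n"; cases "y n"; auto simp: Z2_ltimes_R_def)+
  have "(x, y) \<in> E_rel Z2_ltimes_R Z2_ltimes_R_topology \<longleftrightarrow>
      (\<exists>a l. a \<in> {0, 1} \<and> (\<forall>\<^sub>F n in sequentially. fst (z n) = a) \<and> (\<lambda>n. snd (z n)) \<longlonglongrightarrow> l)"
    using carrier unfolding E_rel_def Z2_ltimes_R_topology_def z_def
    by (auto simp: limitin_pairwise limitin_discrete_topology o_def)
  also have "\<dots> \<longleftrightarrow> (\<exists>c. (\<forall>\<^sub>F n in sequentially. q n = c) \<and>
         convergent (\<lambda>n. snd (x n) - c * snd (y n)))"
  proof
    assume "\<exists>a l. a \<in> {0, 1} \<and> (\<forall>\<^sub>F n in sequentially. fst (z n) = a) \<and> (\<lambda>n. snd (z n)) \<longlonglongrightarrow> l"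
    then obtain a l where a: "\<forall>\<^sub>F n in sequentially. fst (z n) = a" and l: "(\<lambda>n. snd (z n)) \<longlonglongrightarrow> l"
      by blast
    have q: "\<forall>\<^sub>F n in sequentially. q n = (if a = 0 then 1 else - 1)"
      using a by eventually_elim (use z in \<open>auto split: if_splits\<close>)
    then have "\<forall>\<^sub>F n in sequentially. snd (z n) = snd (x n) - (if a = 0 then 1 else - 1) * snd (y n)"
      by eventually_elim (use z in auto)
    then have "(\<lambda>n. snd (x n) - (if a = 0 then 1 else - 1) * snd (y n)) \<longlonglongrightarrow> l"
      using l by (rule Lim_transform_eventually[rotated])
    then show "\<exists>c. (\<forall>\<^sub>F n in sequentially. q n = c) \<and> convergent (\<lambda>n. snd (x n) - c * snd (y n))"
      using q by (auto simp: convergent_def)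
  next
    assume "\<exists>c. (\<forall>\<^sub>F n in sequentially. q n = c) \<and> convergent (\<lambda>n. snd (x n) - c * snd (y n))"
    then obtain c l where c: "\<forall>\<^sub>F n in sequentially. q n = c"
      and l: "(\<lambda>n. snd (x n) - c * snd (y n)) \<longlonglongrightarrow> l"
      unfolding convergent_def by blast
    have "\<forall>\<^sub>F n in sequentially. fst (z n) = (if c = 1 then 0 else 1)"
      using c by eventually_elim (use z in auto)
    moreover have "\<forall>\<^sub>F n in sequentially. snd (x n) - c * snd (y n) = snd (z n)"
      using c by eventually_elim (use z in auto)
    then have "(\<lambda>n. snd (z n)) \<longlonglongrightarrow> l"
      using l by (rule Lim_transform_eventually[rotated])
    ultimately show "\<exists>a l. a \<in> {0, 1} \<and> (\<forall>\<^sub>F n in sequentially. fst (z n) = a) \<and> (\<lambda>n. snd (z n)) \<longlonglongrightarrow> l"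
      by (intro exI[of _ "if c = 1 then 0 else 1"] exI[of _ l]) auto
  qed
  finally show ?thesis unfolding q_def .
qed

section \<open>Non-reducibility to the real line\<close>

text \<open>Infinite words over \<open>nat\<close> describe sequences in \<open>\<int>\<^sub>2 \<ltimes> \<real>\<close> by their successive
  increments: the letter 0 is the identity, 1 is the flip \<open>(1, 0)\<close>, and \<open>k \<ge> 2\<close> is the
  translation \<open>(0, 1 / (k - 1))\<close>.\<close>

definition step_sign :: "nat \<Rightarrow> real" where
  "step_sign k = (if k = 1 then - 1 else 1)"

definition step_size :: "nat \<Rightarrow> real" where
  "step_size k = (if k \<le> 1 then 0 else 1 / real (k - 1))"

definition walk_sign :: "(nat \<Rightarrow> nat) \<Rightarrow> nat \<Rightarrow> real" where
  "walk_sign x n = (\<Prod>i<n. step_sign (x i))"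

definition walk_pos :: "(nat \<Rightarrow> nat) \<Rightarrow> nat \<Rightarrow> real" where
  "walk_pos x n = (\<Sum>i<n. walk_sign x i * step_size (x i))"

definition walk :: "(nat \<Rightarrow> nat) \<Rightarrow> nat \<Rightarrow> nat \<times> real" where
  "walk x n = (if walk_sign x n = 1 then 0 else 1, walk_pos x n)"

lemma walk_sign_cases: "walk_sign x n = 1 \<or> walk_sign x n = - 1"
  by (induction n) (auto simp: walk_sign_def step_sign_def)

lemma walk_sign_square [simp]: "walk_sign x n * walk_sign x n = 1"
  using walk_sign_cases[of x n] by auto

lemma walk_cong:
  assumes "\<And>i. i < n \<Longrightarrow> x i = y i"
  shows "walk_sign x n = walk_sign y n" "walk_pos x n = walk_pos y n"
proof -
  have sign: "walk_sign x m = walk_sign y m" if "m \<le> n" for m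
    unfolding walk_sign_def using assms that by (intro prod.cong) auto
  then show "walk_sign x n = walk_sign y n" by simp
  show "walk_pos x n = walk_pos y n"
    unfolding walk_pos_def using assms sign by (intro sum.cong) auto
qed

text \<open>Past \<open>s\<close> the walk is that of \<open>z\<close>, multiplied on the left by
  the group element reached after \<open>s\<close>.\<close>

lemma walk_conc:
  "walk_sign (s \<frown> z) (length s + n) = walk_sign (s \<frown> z) (length s) * walk_sign z n"
  "walk_pos (s \<frown> z) (length s + n) =
     walk_pos (s \<frown> z) (length s) + walk_sign (s \<frown> z) (length s) * walk_pos z n"
proof -
  show sign: "walk_sign (s \<frown> z) (length s + n) = walk_sign (s \<frown> z) (length s) * walk_sign z n" for n
    by (induction n) (auto simp: walk_sign_def)
  show "walk_pos (s \<frown> z) (length s + n) =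
     walk_pos (s \<frown> z) (length s) + walk_sign (s \<frown> z) (length s) * walk_pos z n"
    by (induction n) (use sign in \<open>auto simp: walk_pos_def algebra_simps\<close>)
qed

lemma E_rel_walk:
  "(walk x, walk y) \<in> E_rel Z2_ltimes_R Z2_ltimes_R_topology \<longleftrightarrow>
    (\<exists>c. (\<forall>\<^sub>F n in sequentially. walk_sign x n * walk_sign y n = c) \<and>
         convergent (\<lambda>n. walk_pos x n - c * walk_pos y n))"
proof -
  have "(-1) ^ fst (walk x n) = walk_sign x n" for x n
    using walk_sign_cases[of x n] by (auto simp: walk_def)
  then show ?thesis
    by (subst E_rel_Z2_ltimes_R) (auto simp: walk_def)
qed

text \<open>Common increments cancel in the quotient, which is therefore constant once both prefixes
  are read. This supplies the hypothesis \<open>conv\<close> of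
  \<open>block_words_four_cycle\<close>.\<close>

lemma E_rel_walk_conc:
  assumes "length s = length s'"
  shows "(walk (s \<frown> z), walk (s' \<frown> z)) \<in> E_rel Z2_ltimes_R Z2_ltimes_R_topology"
proof -
  define k where "k = length s"
  let ?a = "walk_sign (s \<frown> z) k" and ?b = "walk_sign (s' \<frown> z) k"
  have "walk_sign (s \<frown> z) (n + k) * walk_sign (s' \<frown> z) (n + k) = ?a * ?b" for n
  proof -
    have "walk_sign (s \<frown> z) (n + k) * walk_sign (s' \<frown> z) (n + k) =
        ?a * ?b * (walk_sign z n * walk_sign z n)"
      using walk_conc(1)[of s z n] walk_conc(1)[of s' z n] assms by (simp add: k_def add.commute)
    then show ?thesis by simp
  qed
  then have "\<forall>\<^sub>F n in sequentially. walk_sign (s \<frown> z) n * walk_sign (s' \<frown> z) n = ?a * ?b"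
    unfolding eventually_sequentially by (metis le_add_diff_inverse2)
  moreover have "walk_pos (s \<frown> z) (n + k) - ?a * ?b * walk_pos (s' \<frown> z) (n + k) =
      walk_pos (s \<frown> z) k - ?a * ?b * walk_pos (s' \<frown> z) k" for n
  proof -
    have "walk_pos (s \<frown> z) (n + k) - ?a * ?b * walk_pos (s' \<frown> z) (n + k) =
      walk_pos (s \<frown> z) k - ?a * ?b * walk_pos (s' \<frown> z) k + ?a * (1 - ?b * ?b) * walk_pos z n"
      using walk_conc(2)[of s z n] walk_conc(2)[of s' z n] assms
      by (simp add: k_def add.commute) (simp add: algebra_simps)
    then show ?thesis by simp
  qed
  then have "convergent (\<lambda>n. walk_pos (s \<frown> z) (n + k) - ?a * ?b * walk_pos (s' \<frown> z) (n + k))"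
    by (simp add: convergent_const)
  then have "convergent (\<lambda>n. walk_pos (s \<frown> z) n - ?a * ?b * walk_pos (s' \<frown> z) n)"
    by (rule convergent_ignore_initial_segment[THEN iffD1])
  ultimately show ?thesis unfolding E_rel_walk by blast
qed

lemma continuous_map_nat_seq_if_finite_dependence:
  fixes g :: "(nat \<Rightarrow> nat) \<Rightarrow> 'b"
  assumes "\<And>x. g x \<in> topspace Y" and dep: "\<And>x y. (\<And>i. i < n \<Longrightarrow> x i = y i) \<Longrightarrow> g x = g y"
  shows "continuous_map euclidean Y g"
  unfolding continuous_map_def
proof (intro conjI allI impI)
  fix V assume "openin Y V"
  have "\<exists>T. open T \<and> x \<in> T \<and> T \<subseteq> {x. g x \<in> V}" if x: "g x \<in> V" for x
  proof (intro exI conjI)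
    show "open (range ((\<frown>) (Omega_Words_Fun.prefix n x)))" by (rule open_range_conc)
    show "x \<in> range ((\<frown>) (Omega_Words_Fun.prefix n x))"
      by (rule range_eqI[of _ _ "\<lambda>i. x (n + i)"]) (auto simp: conc_def fun_eq_iff)
    show "range ((\<frown>) (Omega_Words_Fun.prefix n x)) \<subseteq> {x. g x \<in> V}"
    proof clarify
      fix z
      have "g (Omega_Words_Fun.prefix n x \<frown> z) = g x" by (rule dep) simp
      then show "g (Omega_Words_Fun.prefix n x \<frown> z) \<in> V" using x by simp
    qed
  qed
  then have "open {x. g x \<in> V}" by (subst open_subopen) auto
  then show "openin euclidean {x \<in> topspace euclidean. g x \<in> V}" by simp
qed (use assms(1) in auto)

lemma continuous_map_walk: "continuous_map euclidean (seq_topology Z2_ltimes_R_topology) walk"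
  unfolding seq_topology_def continuous_map_componentwise_UNIV
proof
  fix n
  show "continuous_map euclidean Z2_ltimes_R_topology (\<lambda>x. walk x n)"
  proof (rule continuous_map_nat_seq_if_finite_dependence)
    show "walk x n \<in> topspace Z2_ltimes_R_topology" for x
      by (simp add: walk_def Z2_ltimes_R_topology_def)
    show "walk x n = walk y n" if "\<And>i. i < n \<Longrightarrow> x i = y i" for x y
      using walk_cong[OF that] by (simp add: walk_def)
  qed
qed


section \<open>Walks along block words and series with prescribed signs\<close>

text \<open>A change of sign from \<open>t (i - 1)\<close> to \<open>t i\<close>, with initial sign
  1, is produced by a factor \<open>- 1\<close> at index \<open>2 * i\<close>. The odd indices
  remain free for translations.\<close>

lemma prescribed_partial_products:
  fixes t :: "nat \<Rightarrow> real"
  assumes "\<And>i. t i = 1 \<or> t i = - 1"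
  obtains S :: "nat set" where "\<And>j. j \<in> S \<Longrightarrow> even j"
    "\<And>i. (\<Prod>j<2 * i + 1. if j \<in> S then - 1 else 1) = t i"
proof
  define S where "S = {j. even j \<and> t (j div 2) \<noteq> (if j = 0 then 1 else t (j div 2 - 1))}"
  show "even j" if "j \<in> S" for j using that by (simp add: S_def)
  show "(\<Prod>j<2 * i + 1. if j \<in> S then - 1 else 1) = t i" for i
  proof (induction i)
    case 0
    show ?case using assms[of 0] by (auto simp: S_def)
  next
    case (Suc i)
    have "2 * Suc i + 1 = Suc (Suc (2 * i + 1))" by simp
    then show ?case
      using Suc.IH assms[of i] assms[of "Suc i"] by (auto simp: S_def)
  qed
qed

lemma block_word_site:
  "\<exists>z. block_word w v B = block_prefix w v B j \<frown> (w j @ [if j \<in> B then v j else 0]) \<frown> z"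
proof -
  obtain z where z: "block_word w v B = (block_prefix w v B (Suc j) @ w (Suc j)) \<frown> z"
    using block_word_split[of "Suc j" B B w v] by blast
  show ?thesis
    by (rule exI[of _ "w (Suc j) \<frown> z"]) (simp only: z conc_conc block_prefix.simps append_assoc)
qed

text \<open>Even sites offer a flip. An odd site \<open>j\<close> offers the translation by
  \<open>1 / j\<close>, which is the letter \<open>Suc j\<close>. Block \<open>j\<close> starts at
  position \<open>k j\<close>, whatever \<open>B\<close> is.\<close>

context
  fixes w :: "nat \<Rightarrow> nat list" and v :: "nat \<Rightarrow> nat" and k :: "nat \<Rightarrow> nat"
  defines "v \<equiv> (\<lambda>j. if even j then 1 else Suc j)"
    and "k \<equiv> (\<lambda>j. length (block_prefix w v {} j))"
begin

lemma length_block_prefix: "length (block_prefix w v B j) = k j"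
  unfolding k_def by (rule length_block_prefix_eq)

lemma k_simps: "k 0 = 0" "k (Suc j) = Suc (k j + length (w j))"
  by (simp_all add: k_def)

text \<open>Within a filler the walk repeats the filler's own walk from the group element reached at
  \<open>k j\<close>. The zeros that pad \<open>w j\<close> to an infinite word are never read,
  since \<open>i \<le> length (w j)\<close>.\<close>

lemma walk_block:
  assumes "i \<le> length (w j)"
  shows "walk_sign (block_word w v B) (k j + i) =
           walk_sign (block_word w v B) (k j) * walk_sign (w j \<frown> (\<lambda>_. 0)) i"
    "walk_pos (block_word w v B) (k j + i) =
       walk_pos (block_word w v B) (k j) + walk_sign (block_word w v B) (k j) * walk_pos (w j \<frown> (\<lambda>_. 0)) i"
proof -
  obtain z where z: "block_word w v B = block_prefix w v B j \<frown> (w j @ [if j \<in> B then v j else 0]) \<frown> z"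
    using block_word_site by blast
  let ?y = "(w j @ [if j \<in> B then v j else 0]) \<frown> z"
  have "?y m = (w j \<frown> (\<lambda>_. 0)) m" if "m < i" for m
    using that assms by (simp add: nth_append)
  note cong = walk_cong[of i ?y "w j \<frown> (\<lambda>_. 0)", OF this]
  show "walk_sign (block_word w v B) (k j + i) =
           walk_sign (block_word w v B) (k j) * walk_sign (w j \<frown> (\<lambda>_. 0)) i"
    unfolding z using walk_conc(1)[of "block_prefix w v B j" ?y i] cong(1)
    unfolding length_block_prefix by simp
  show "walk_pos (block_word w v B) (k j + i) =
       walk_pos (block_word w v B) (k j) + walk_sign (block_word w v B) (k j) * walk_pos (w j \<frown> (\<lambda>_. 0)) i"
    unfolding z using walk_conc(2)[of "block_prefix w v B j" ?y i] cong(2)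
    unfolding length_block_prefix by simp
qed

lemma block_word_at_site:
  "block_word w v B (k j + length (w j)) = (if j \<in> B then v j else 0)"
proof -
  have "block_word w v B (k j + length (w j)) = block_prefix w v B (Suc j) ! (k j + length (w j))"
    by (rule block_word_nth) (simp add: length_block_prefix)
  also have "\<dots> = (if j \<in> B then v j else 0)"
    by (simp add: nth_append length_block_prefix)
  finally show ?thesis .
qed

text \<open>The site comes after the filler, so its translation is also reflected by the sign
  \<open>u\<close> of the filler, while a flip affects later letters only.\<close>

lemma walk_block_Suc:
  fixes B j
  defines "u \<equiv> walk_sign (w j \<frown> (\<lambda>_. 0)) (length (w j))"
  shows "walk_sign (block_word w v B) (k (Suc j)) =
           walk_sign (block_word w v B) (k j) * u * (if even j \<and> j \<in> B then - 1 else 1)"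
    "walk_pos (block_word w v B) (k (Suc j)) =
       walk_pos (block_word w v B) (k j) + walk_sign (block_word w v B) (k j) *
         (walk_pos (w j \<frown> (\<lambda>_. 0)) (length (w j)) + u * (if odd j \<and> j \<in> B then 1 / real j else 0))"
proof -
  show "walk_sign (block_word w v B) (k (Suc j)) =
           walk_sign (block_word w v B) (k j) * u * (if even j \<and> j \<in> B then - 1 else 1)"
    using walk_block(1)[of "length (w j)" j B] block_word_at_site[of B j]
    unfolding k_simps u_def by (auto simp: walk_sign_def v_def step_sign_def)
  have "walk_pos (block_word w v B) (Suc (k j + length (w j))) =
      walk_pos (block_word w v B) (k j + length (w j)) +
      walk_sign (block_word w v B) (k j + length (w j)) * step_size (if j \<in> B then v j else 0)"
    using block_word_at_site[of B j] by (simp add: walk_pos_def)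
  moreover have "step_size (if j \<in> B then v j else 0) = (if odd j \<and> j \<in> B then 1 / real j else 0)"
    by (cases j) (auto simp: step_size_def v_def)
  ultimately show "walk_pos (block_word w v B) (k (Suc j)) =
       walk_pos (block_word w v B) (k j) + walk_sign (block_word w v B) (k j) *
         (walk_pos (w j \<frown> (\<lambda>_. 0)) (length (w j)) + u * (if odd j \<and> j \<in> B then 1 / real j else 0))"
    using walk_block[of "length (w j)" j B]
    unfolding k_simps u_def by (simp add: algebra_simps)
qed

lemma k_blocks: "\<exists>j. k j \<le> n \<and> n < k (Suc j)"
proof -
  have "n < k (Suc n)"
    using length_block_prefix_ge[of "Suc n" w v "{}"] unfolding k_def by linarith
  then have "\<exists>j. k j \<le> n \<and> n < k (Suc j)" if "n < k i" for i
    using that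
  proof (induction i)
    case (Suc i)
    then show ?case by (cases "n < k i") (auto simp: not_less)
  qed (simp add: k_simps)
  then show ?thesis using \<open>n < k (Suc n)\<close> by blast
qed

lemma k_mono: "i \<le> j \<Longrightarrow> k i \<le> k j"
  by (induction j rule: dec_induct) (auto simp: k_simps)

text \<open>Flips at the even sites control the signs with which the steps \<open>1 / (2 * m + 1)\<close>
  at the odd sites are added up.\<close>

lemma E_rel_walk_block_word_iff_summable:
  fixes t :: "nat \<Rightarrow> real"
  assumes t: "\<And>i. t i = 1 \<or> t i = - 1"
  shows "\<exists>S. (\<forall>j\<in>S. even j) \<and>
    ((walk (block_word w v (S \<union> {j. odd j})), walk (block_word w v S)) \<in>
       E_rel Z2_ltimes_R Z2_ltimes_R_topology \<longleftrightarrow> summable (\<lambda>m. t m / (2 * real m + 1)))"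
proof -
  define u where "u j = walk_sign (w j \<frown> (\<lambda>_. 0)) (length (w j))" for j
  \<comment> \<open>The total sign of the fillers before site \<open>j - 1\<close> and of filler
    \<open>j - 1\<close> itself; it cannot be controlled and is absorbed into the choice of
    \<open>S\<close>.\<close>
  define \<gamma> where "\<gamma> j = (\<Prod>i<j. u i)" for j
  have u: "u j = 1 \<or> u j = - 1" for j unfolding u_def by (rule walk_sign_cases)
  have \<gamma>: "\<gamma> j = 1 \<or> \<gamma> j = - 1" for j
  proof (induction j)
    case (Suc j)
    then show ?case using u[of j] by (auto simp: \<gamma>_def)
  qed (simp add: \<gamma>_def)
  \<comment> \<open>The translation at site \<open>2 * i + 1\<close> comes after the fillers
    \<open>0\<close> to \<open>2 * i + 1\<close>, hence index \<open>2 * i + 2\<close>, and after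
    the flips at sites up to \<open>2 * i\<close>.\<close>
  have "\<gamma> (2 * i + 2) * t i = 1 \<or> \<gamma> (2 * i + 2) * t i = - 1" for i
    using \<gamma>[of "2 * i + 2"] t[of i] by auto
  then obtain S where even_S: "\<And>j. j \<in> S \<Longrightarrow> even j"
    and S: "\<And>i. (\<Prod>j<2 * i + 1. if j \<in> S then - 1 else 1) = \<gamma> (2 * i + 2) * t i"
    using prescribed_partial_products[of "\<lambda>i. \<gamma> (2 * i + 2) * t i"] by blast
  let ?x = "block_word w v (S \<union> {j. odd j})" and ?y = "block_word w v S"
  define \<sigma> where "\<sigma> B j = walk_sign (block_word w v B) (k j)" for B j
  have \<sigma>_eq: "\<sigma> B j = \<gamma> j * (\<Prod>i<j. if i \<in> S then - 1 else 1)" if "\<And>i. even i \<Longrightarrow> i \<in> B \<longleftrightarrow> i \<in> S" for B j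
  proof (induction j)
    case 0
    show ?case by (simp add: \<sigma>_def \<gamma>_def k_simps walk_sign_def)
  next
    case (Suc j)
    have "(if even j \<and> j \<in> B then - 1 else 1) = (if j \<in> S then - 1 else (1::real))"
      using that[of j] even_S[of j] by auto
    then show ?case
      using Suc.IH walk_block_Suc(1)[where B=B and j=j] unfolding \<sigma>_def \<gamma>_def u_def by simp
  qed
  \<comment> \<open>Equal flips give equal signs, so translations inside the fillers cancel in
    \<open>\<Delta>\<close> below.\<close>
  have \<sigma>_same: "\<sigma> (S \<union> {j. odd j}) j = \<sigma> S j" for j
    by (simp add: \<sigma>_eq)
  have sign_t: "\<sigma> S (2 * i + 1) * u (2 * i + 1) = t i" for i
  proof -
    have "\<sigma> S (2 * i + 1) * u (2 * i + 1) = \<gamma> (2 * i + 2) * (\<gamma> (2 * i + 2) * t i)"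
      unfolding \<sigma>_eq[of S, simplified] S[symmetric] by (simp add: \<gamma>_def)
    then show ?thesis using \<gamma>[of "2 * i + 2"] by auto
  qed
  define p where "p i = (\<Sum>m<i. t m / (2 * real m + 1))" for i
  define \<Delta> where "\<Delta> j = walk_pos ?x (k j) - walk_pos ?y (k j)" for j
  have \<Delta>_Suc: "\<Delta> (Suc j) = \<Delta> j + (if odd j then \<sigma> S j * u j / real j else 0)" for j
    unfolding \<Delta>_def walk_block_Suc(2) using \<sigma>_same[of j] even_S[of j]
    unfolding \<sigma>_def u_def by (auto simp: algebra_simps)
  have \<Delta>_even: "\<Delta> (2 * i) = p i" for i
  proof (induction i)
    case 0
    show ?case by (simp add: \<Delta>_def p_def k_simps walk_pos_def)
  next
    case (Suc i)
    have "\<Delta> (2 * Suc i) = \<Delta> (Suc (Suc (2 * i)))" by simp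
    also have "\<dots> = p i + \<sigma> S (2 * i + 1) * u (2 * i + 1) / real (2 * i + 1)"
      unfolding \<Delta>_Suc using Suc.IH by simp
    finally show ?case unfolding sign_t by (simp add: p_def)
  qed
  have \<Delta>_eq: "\<Delta> j = p (j div 2)" for j
  proof (cases "even j")
    case True
    then show ?thesis using \<Delta>_even[of "j div 2"] by simp
  next
    case False
    then obtain i where "j = Suc (2 * i)" by (auto elim: oddE)
    then show ?thesis using \<Delta>_Suc[of "2 * i"] \<Delta>_even[of i] by simp
  qed
  \<comment> \<open>\<open>J n\<close> is the block that contains position \<open>n\<close>. The
    difference of the two positions is constant within a block, so only the values at block
    boundaries matter.\<close>
  obtain J where J: "\<And>n. k (J n) \<le> n" "\<And>n. n < k (Suc (J n))"
    using k_blocks by metis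
  have walk_n: "walk_sign ?x n = walk_sign ?y n" "walk_pos ?x n - walk_pos ?y n = p (J n div 2)" for n
  proof -
    define i where "i = n - k (J n)"
    have i: "n = k (J n) + i" "i \<le> length (w (J n))"
      using J[of n] by (auto simp: i_def k_simps)
    show "walk_sign ?x n = walk_sign ?y n"
      using walk_block(1)[OF i(2), of "S \<union> {j. odd j}"] walk_block(1)[OF i(2), of S] \<sigma>_same[of "J n"] i(1)
      unfolding \<sigma>_def by simp
    have "walk_pos ?x n - walk_pos ?y n = \<Delta> (J n)"
      using walk_block(2)[OF i(2), of "S \<union> {j. odd j}"] walk_block(2)[OF i(2), of S] \<sigma>_same[of "J n"] i(1)
      unfolding \<sigma>_def \<Delta>_def by simp
    then show "walk_pos ?x n - walk_pos ?y n = p (J n div 2)" by (simp add: \<Delta>_eq)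
  qed
  have "(walk ?x, walk ?y) \<in> E_rel Z2_ltimes_R Z2_ltimes_R_topology \<longleftrightarrow>
      convergent (\<lambda>n. walk_pos ?x n - walk_pos ?y n)"
    unfolding E_rel_walk walk_n(1) walk_sign_square by auto
  also have "\<dots> \<longleftrightarrow> convergent p"
  proof
    assume "convergent (\<lambda>n. walk_pos ?x n - walk_pos ?y n)"
    then obtain L where L: "(\<lambda>n. walk_pos ?x n - walk_pos ?y n) \<longlonglongrightarrow> L"
      by (auto simp: convergent_def)
    have "strict_mono (\<lambda>i. k (2 * i))"
      by (auto simp: strict_mono_Suc_iff k_simps)
    from LIMSEQ_subseq_LIMSEQ[OF L this] have "(\<lambda>i. \<Delta> (2 * i)) \<longlonglongrightarrow> L"
      by (simp add: o_def \<Delta>_def)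
    then show "convergent p" unfolding \<Delta>_even by (auto simp: convergent_def)
  next
    assume "convergent p"
    then obtain L where L: "p \<longlonglongrightarrow> L" by (auto simp: convergent_def)
    have "filterlim (\<lambda>n. J n div 2) at_top sequentially"
      unfolding filterlim_at_top eventually_sequentially
    proof (intro allI exI impI)
      fix Z n assume "k (2 * Z) \<le> n"
      then have "\<not> Suc (J n) \<le> 2 * Z"
        using J(2)[of n] k_mono[of "Suc (J n)" "2 * Z"] by linarith
      then show "Z \<le> J n div 2" by simp
    qed
    from filterlim_compose[OF L this] show "convergent (\<lambda>n. walk_pos ?x n - walk_pos ?y n)"
      unfolding walk_n(2) by (auto simp: convergent_def)
  qed
  also have "\<dots> \<longleftrightarrow> summable (\<lambda>m. t m / (2 * real m + 1))"
    unfolding p_def summable_iff_convergent ..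
  finally show ?thesis using even_S by (intro exI[of _ S] conjI) auto
qed

end

lemma not_borel_reducible_Z2_ltimes_R_real_group:
  "\<not> borel_reducible (seq_topology Z2_ltimes_R_topology) (E_rel Z2_ltimes_R Z2_ltimes_R_topology)
       (seq_topology euclideanreal) (E_rel real_group euclideanreal)"
proof
  assume "borel_reducible (seq_topology Z2_ltimes_R_topology) (E_rel Z2_ltimes_R Z2_ltimes_R_topology)
       (seq_topology euclideanreal) (E_rel real_group euclideanreal)"
  then obtain f where f: "f \<in> borel_of (seq_topology Z2_ltimes_R_topology) \<rightarrow>\<^sub>M borel_of (seq_topology euclideanreal)"
    and red: "\<And>x y. x \<in> topspace (seq_topology Z2_ltimes_R_topology) \<Longrightarrow>
      y \<in> topspace (seq_topology Z2_ltimes_R_topology) \<Longrightarrow>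
      (x, y) \<in> E_rel Z2_ltimes_R Z2_ltimes_R_topology \<longleftrightarrow> convergent (\<lambda>n. f x n - f y n)"
    unfolding borel_reducible_def E_rel_real_group by blast
  have walk_top: "walk x \<in> topspace (seq_topology Z2_ltimes_R_topology)" for x
    using continuous_map_walk by (auto simp: continuous_map_def)
  have f_walk: "(walk x, walk y) \<in> E_rel Z2_ltimes_R Z2_ltimes_R_topology \<longleftrightarrow>
      convergent (\<lambda>n. f (walk x) n - f (walk y) n)" for x y
    by (rule red[OF walk_top walk_top])
  have borel: "(\<lambda>x. f (walk x) n) \<in> borel_measurable borel" for n
  proof -
    have walk: "walk \<in> borel \<rightarrow>\<^sub>M borel_of (seq_topology Z2_ltimes_R_topology)"
      using continuous_map_measurable_borel_of[OF continuous_map_walk] by (simp add: borel_of_euclidean)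
    have "continuous_map (seq_topology euclideanreal) euclideanreal (\<lambda>y. y n)"
      unfolding seq_topology_def by (rule continuous_map_product_projection) simp
    then have proj: "(\<lambda>y. y n) \<in> borel_of (seq_topology euclideanreal) \<rightarrow>\<^sub>M borel"
      using continuous_map_measurable_borel_of by (metis borel_of_euclidean)
    show ?thesis
      using measurable_compose[OF measurable_compose[OF walk f] proj] by simp
  qed
  have conv: "convergent (\<lambda>n. f (walk (s \<frown> z)) n - f (walk (s' \<frown> z)) n)"
    if "length s = length s'" for s s' z
    using E_rel_walk_conc[OF that] f_walk by blast
  let ?v = "\<lambda>j. if even j then 1 else Suc j"
  from block_words_four_cycle[of "\<lambda>x. f (walk x)" ?v, OF borel conv]
  obtain w where four_cycle: "\<forall>B\<^sub>1 B\<^sub>2 B\<^sub>3 B\<^sub>4.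
    (\<forall>j. (j \<in> B\<^sub>1 \<longleftrightarrow> j \<in> B\<^sub>3) \<and> (j \<in> B\<^sub>2 \<longleftrightarrow> j \<in> B\<^sub>4) \<or> (j \<in> B\<^sub>1 \<longleftrightarrow> j \<in> B\<^sub>2) \<and> (j \<in> B\<^sub>3 \<longleftrightarrow> j \<in> B\<^sub>4)) \<longrightarrow>
    convergent (\<lambda>n. f (walk (block_word w ?v B\<^sub>1)) n - f (walk (block_word w ?v B\<^sub>2)) n
                  - f (walk (block_word w ?v B\<^sub>3)) n + f (walk (block_word w ?v B\<^sub>4)) n)" ..
  let ?x = "block_word w ?v"
  have "\<exists>S. (\<forall>j\<in>S. even j) \<and>
    ((walk (?x (S \<union> {j. odd j})), walk (?x S)) \<in> E_rel Z2_ltimes_R Z2_ltimes_R_topology \<longleftrightarrow>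
       summable (\<lambda>m. 1 / (2 * real m + 1)))"
    using E_rel_walk_block_word_iff_summable[of "\<lambda>_. 1" w] by simp
  then obtain S where S: "\<forall>j\<in>S. even j"
    "(walk (?x (S \<union> {j. odd j})), walk (?x S)) \<in> E_rel Z2_ltimes_R Z2_ltimes_R_topology \<longleftrightarrow>
       summable (\<lambda>m. 1 / (2 * real m + 1))"
    by (elim exE conjE)
  have "(-1 :: real) ^ m = 1 \<or> (-1 :: real) ^ m = - 1" for m :: nat
    by (cases "even m") auto
  from E_rel_walk_block_word_iff_summable[of "\<lambda>m. (-1) ^ m" w, OF this]
  obtain S' where S': "\<forall>j\<in>S'. even j"
    "(walk (?x (S' \<union> {j. odd j})), walk (?x S')) \<in> E_rel Z2_ltimes_R Z2_ltimes_R_topology \<longleftrightarrow>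
       summable (\<lambda>m. (-1) ^ m / (2 * real m + 1))"
    by (elim exE conjE)
  \<comment> \<open>Comparison with the harmonic series, as
    \<open>2 / (2 * m + 1) \<ge> 1 / (m + 1)\<close>.\<close>
  have "\<not> summable (\<lambda>m. 1 / (2 * real m + 1))"
  proof
    assume "summable (\<lambda>m. 1 / (2 * real m + 1))"
    then have "summable (\<lambda>m. 2 * (1 / (2 * real m + 1)))" by (rule summable_mult)
    then have "summable (\<lambda>m. inverse (of_nat (Suc m)) :: real)"
      by (rule summable_comparison_test'[where N=0]) (auto simp: field_simps)
    then show False
      using not_summable_harmonic[where 'a=real] summable_Suc_iff[of "\<lambda>n. inverse (real n)"] by blast
  qed
  then have "\<not> convergent (\<lambda>n. f (walk (?x (S \<union> {j. odd j}))) n - f (walk (?x S)) n)"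
    using S(2) f_walk by blast
  \<comment> \<open>This is the arctangent series at 1.\<close>
  moreover have "summable (\<lambda>m. (-1) ^ m / (2 * real m + 1))"
    using summable_arctan_series[of 1] by (simp add: mult.commute add.commute)
  then have "convergent (\<lambda>n. f (walk (?x (S' \<union> {j. odd j}))) n - f (walk (?x S')) n)"
    using S'(2) f_walk by blast
  \<comment> \<open>At odd sites the first and third words use the letter and the other two do not.
    At even sites the flips agree within each pair \<open>S\<close> and within each pair
    \<open>S'\<close>. So the four-cycle condition holds although \<open>S\<close> and
    \<open>S'\<close> are unrelated.\<close>
  moreover have "convergent (\<lambda>n. f (walk (?x (S \<union> {j. odd j}))) n - f (walk (?x S)) n
      - f (walk (?x (S' \<union> {j. odd j}))) n + f (walk (?x S')) n)"
    by (rule four_cycle[rule_format]) (use S(1) S'(1) in auto)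
  from convergent_add[OF this calculation(2)]
  have "convergent (\<lambda>n. f (walk (?x (S \<union> {j. odd j}))) n - f (walk (?x S)) n)"
    by (simp add: algebra_simps)
  ultimately show False by blast
qed

section \<open>Open normal subgroups isomorphic to the real line\<close>

lemma topological_group_continuous_mult:
  assumes "topological_group G T" "continuous_map X T f" "continuous_map X T g"
  shows "continuous_map X T (\<lambda>x. f x \<otimes>\<^bsub>G\<^esub> g x)"
proof -
  have "continuous_map X (prod_topology T T) (\<lambda>x. (f x, g x))"
    using assms by (intro continuous_map_pairedI)
  from continuous_map_compose[OF this] assms(1) show ?thesis
    unfolding topological_group_def by (fastforce simp: o_def)
qed

lemma topological_group_continuous_inv:
  assumes "topological_group G T" "continuous_map X T f"
  shows "continuous_map X T (\<lambda>x. inv\<^bsub>G\<^esub> (f x))"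
  using continuous_map_compose[OF assms(2), of T "\<lambda>x. inv\<^bsub>G\<^esub> x"] assms(1)
  unfolding topological_group_def by (simp add: o_def)

lemma topological_group_continuous_left_mult:
  assumes "topological_group G T" "a \<in> carrier G"
  shows "continuous_map T T (\<lambda>x. a \<otimes>\<^bsub>G\<^esub> x)"
  using assms by (intro topological_group_continuous_mult) (auto simp: topological_group_def)

lemma identity_component_maximal:
  "connectedin T S \<Longrightarrow> \<one>\<^bsub>G\<^esub> \<in> S \<Longrightarrow> S \<subseteq> identity_component G T"
  unfolding identity_component_def by (rule connected_component_of_maximal)

lemma identity_component_continuous_image_subset:
  assumes "continuous_map T T f" "x \<in> identity_component G T" "f x = \<one>\<^bsub>G\<^esub>"
  shows "f ` identity_component G T \<subseteq> identity_component G T"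
proof (rule identity_component_maximal)
  show "connectedin T (f ` identity_component G T)"
    using assms(1) connectedin_connected_component_of[of T "\<one>\<^bsub>G\<^esub>"]
    unfolding identity_component_def by (rule connectedin_continuous_map_image)
  show "\<one>\<^bsub>G\<^esub> \<in> f ` identity_component G T" using assms(2,3) by force
qed

lemma normal_identity_component:
  fixes G (structure)
  assumes tg: "topological_group G T"
  shows "identity_component G T \<lhd> G"
proof -
  interpret group G using tg by (simp add: topological_group_def)
  have top: "topspace T = carrier G" using tg by (simp add: topological_group_def)
  let ?N = "identity_component G T"
  have sub: "?N \<subseteq> carrier G"
    unfolding identity_component_def top[symmetric] by (rule connected_component_of_subset_topspace)
  have one: "\<one> \<in> ?N"
    unfolding identity_component_def using top by (simp add: connected_component_of_refl)
  have div: "inv x \<otimes> y \<in> ?N" if "x \<in> ?N" "y \<in> ?N" for x y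
  proof -
    have "x \<in> carrier G" using that sub by blast
    then have "(\<lambda>y. inv x \<otimes> y) ` ?N \<subseteq> ?N"
      using that by (intro identity_component_continuous_image_subset[of T _ x]
          topological_group_continuous_left_mult[OF tg]) auto
    then show ?thesis using that by blast
  qed
  have inv: "inv x \<in> ?N" if "x \<in> ?N" for x
    using div[OF that one] that sub by auto
  have "subgroup ?N G"
  proof (rule subgroupI)
    show "a \<otimes> b \<in> ?N" if "a \<in> ?N" "b \<in> ?N" for a b
      using div[OF inv[OF that(1)] that(2)] that sub by (simp add: subsetD)
  qed (use sub one inv in auto)
  moreover have "x \<otimes> h \<otimes> inv x \<in> ?N" if "x \<in> carrier G" "h \<in> ?N" for x h
  proof -
    have "(\<lambda>h. x \<otimes> h \<otimes> inv x) ` ?N \<subseteq> ?N"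
      using that(1) one top
      by (intro identity_component_continuous_image_subset[of T _ \<one>]
          topological_group_continuous_mult[OF tg]) auto
    then show ?thesis using that by blast
  qed
  ultimately show ?thesis by (simp add: normal_inv_iff)
qed

text \<open>A coordinate ball around the identity is connected, hence lies in the component; its
  left translates do the same around every other point.\<close>

lemma openin_identity_component:
  fixes G (structure) and c :: "('a, 'e::euclidean_space) chart"
  assumes tg: "topological_group G T" and chart: "is_chart T c" "\<one> \<in> fst c"
  shows "openin T (identity_component G T)"
proof -
  interpret group G using tg by (simp add: topological_group_def)
  interpret N: normal "identity_component G T" G by (rule normal_identity_component[OF tg])
  have top: "topspace T = carrier G" using tg by (simp add: topological_group_def)
  let ?N = "identity_component G T"
  obtain U \<phi> where c: "c = (U, \<phi>)" by (cases c)
  have U: "openin T U" "open (\<phi> ` U)" "\<one> \<in> U"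
    and \<phi>: "homeomorphic_map (subtopology T U) (top_of_set (\<phi> ` U)) \<phi>"
    using chart unfolding c is_chart_def by auto
  have topU: "topspace (subtopology T U) = U"
    using U(1) openin_subset by fastforce
  obtain r where r: "r > 0" "ball (\<phi> \<one>) r \<subseteq> \<phi> ` U"
    using U(2,3) openE by blast
  define W where "W = {x \<in> U. \<phi> x \<in> ball (\<phi> \<one>) r}"
  have "\<phi> ` W = ball (\<phi> \<one>) r" using r by (auto simp: W_def)
  then have "connectedin (top_of_set (\<phi> ` U)) (\<phi> ` W)"
    using r by (simp add: connectedin_subtopology)
  then have "connectedin (subtopology T U) W"
    using homeomorphic_map_connectedness[OF \<phi>, of W] topU by (auto simp: W_def)
  then have "connectedin T W" by (simp add: connectedin_subtopology)
  moreover have "\<one> \<in> W" using r U by (simp add: W_def)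
  ultimately have W_sub: "W \<subseteq> ?N" by (rule identity_component_maximal)
  have "openin (subtopology T U) {x \<in> topspace (subtopology T U). \<phi> x \<in> ball (\<phi> \<one>) r}"
    using r by (intro openin_continuous_map_preimage[OF homeomorphic_imp_continuous_map[OF \<phi>]])
      (auto simp: openin_open_eq U(2) openin_open intro!: exI[of _ "ball (\<phi> \<one>) r"])
  then have W_open: "openin T W"
    unfolding topU W_def[symmetric] using U(1) by (simp add: openin_open_subtopology)
  show ?thesis
  proof (subst openin_subopen, intro ballI)
    fix x assume x: "x \<in> ?N"
    let ?V = "{y \<in> topspace T. inv x \<otimes> y \<in> W}"
    have "openin T ?V"
      using x W_open by (intro openin_continuous_map_preimage[OF topological_group_continuous_left_mult[OF tg]]) auto
    moreover have "x \<in> ?V" using x \<open>\<one> \<in> W\<close> top by simp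
    moreover have "?V \<subseteq> ?N"
    proof
      fix y assume "y \<in> ?V"
      then have y: "y \<in> carrier G" "inv x \<otimes> y \<in> ?N" using W_sub top by auto
      have "x \<otimes> (inv x \<otimes> y) \<in> ?N" using x y(2) by (rule N.m_closed)
      then show "y \<in> ?N" using x y by (simp add: m_assoc[symmetric])
    qed
    ultimately show "\<exists>V. openin T V \<and> x \<in> V \<and> V \<subseteq> ?N" by blast
  qed
qed

lemma (in group) inv_cancel_left:
  assumes "x \<in> carrier G" "y \<in> carrier G"
  shows "inv x \<otimes> (x \<otimes> y) = y" "x \<otimes> (inv x \<otimes> y) = y"
  using assms by (simp_all add: m_assoc[symmetric])

text \<open>Every left coset is open and meets a countable dense set; the least index of a dense
  point in the coset is its code.\<close>

lemma coset_code_exists: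
  fixes G (structure)
  assumes tg: "topological_group G T" and "separable_space T" "subgroup N G" "openin T N"
  obtains \<kappa> :: "'a \<Rightarrow> nat" where
    "\<And>x y. x \<in> carrier G \<Longrightarrow> y \<in> carrier G \<Longrightarrow> \<kappa> x = \<kappa> y \<longleftrightarrow> inv x \<otimes> y \<in> N"
proof -
  interpret group G using tg by (simp add: topological_group_def)
  interpret N: subgroup N G by fact
  have top: "topspace T = carrier G" using tg by (simp add: topological_group_def)
  obtain C where C: "countable C" "C \<subseteq> carrier G" "T closure_of C = carrier G"
    using assms(2) unfolding separable_space_def top by blast
  define Q where "Q x = {n. \<exists>c\<in>C. to_nat_on C c = n \<and> inv x \<otimes> c \<in> N}" for x
  define \<kappa> where "\<kappa> x = (LEAST n. n \<in> Q x)" for x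
  have \<kappa>: "\<kappa> x \<in> Q x" if x: "x \<in> carrier G" for x
  proof -
    let ?V = "{y \<in> topspace T. inv x \<otimes> y \<in> N}"
    have "openin T ?V"
      using x assms(4) by (intro openin_continuous_map_preimage[OF topological_group_continuous_left_mult[OF tg]]) auto
    moreover have "x \<in> ?V" using x top by simp
    moreover have "\<forall>V. x \<in> V \<and> openin T V \<longrightarrow> (\<exists>y. y \<in> C \<and> y \<in> V)"
      using C(3) x in_closure_of[of x T C] by simp
    ultimately have "\<exists>c. c \<in> C \<and> c \<in> ?V" by (metis (no_types, lifting))
    then have "\<exists>n. n \<in> Q x" unfolding Q_def by blast
    then show ?thesis unfolding \<kappa>_def by (rule LeastI_ex)
  qed
  have div: "inv x \<otimes> y = (inv x \<otimes> c) \<otimes> inv (inv y \<otimes> c)"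
    if "x \<in> carrier G" "y \<in> carrier G" "c \<in> carrier G" for x y c
    using that by (simp add: inv_mult_group m_assoc inv_cancel_left)
  show ?thesis
  proof
    fix x y assume xy: "x \<in> carrier G" "y \<in> carrier G"
    show "\<kappa> x = \<kappa> y \<longleftrightarrow> inv x \<otimes> y \<in> N"
    proof
      assume eq: "\<kappa> x = \<kappa> y"
      obtain c c' where c: "c \<in> C" "to_nat_on C c = \<kappa> x" "inv x \<otimes> c \<in> N"
        "c' \<in> C" "to_nat_on C c' = \<kappa> y" "inv y \<otimes> c' \<in> N"
        using \<kappa>[OF xy(1)] \<kappa>[OF xy(2)] unfolding Q_def by blast
      then have "c = c'" using eq C(1) by (metis to_nat_on_inj)
      then show "inv x \<otimes> y \<in> N"
        using c C(2) xy div[of x y c] by (metis N.m_closed N.m_inv_closed subsetD)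
    next
      assume N: "inv x \<otimes> y \<in> N"
      have "inv x \<otimes> c \<in> N \<longleftrightarrow> inv y \<otimes> c \<in> N" if "c \<in> C" for c
      proof -
        have c: "c \<in> carrier G" using that C by blast
        have 1: "inv x \<otimes> c = (inv x \<otimes> y) \<otimes> (inv y \<otimes> c)"
          using xy c by (simp add: m_assoc inv_cancel_left)
        have 2: "inv y \<otimes> c = inv (inv x \<otimes> y) \<otimes> (inv x \<otimes> c)"
          using xy c by (simp add: m_assoc inv_mult_group inv_cancel_left)
        show ?thesis using 1 2 N by (metis N.m_closed N.m_inv_closed)
      qed
      then have "Q x = Q y" by (auto simp: Q_def)
      then show "\<kappa> x = \<kappa> y" by (simp add: \<kappa>_def)
    qed
  qed
qed

lemma additive_continuous_real:
  fixes f :: "real \<Rightarrow> real"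
  assumes add: "\<And>x y. f (x + y) = f x + f y" and cont: "continuous_on UNIV f"
  shows "f x = f 1 * x"
proof -
  have zero: "f 0 = 0" using add[of 0 0] by simp
  have minus: "f (- x) = - f x" for x using add[of x "- x"] zero by simp
  have nat: "f (real n * x) = real n * f x" for n x
    by (induction n) (auto simp: zero add distrib_right)
  have int: "f (real_of_int k * x) = real_of_int k * f x" for k x
    using nat[of "nat \<bar>k\<bar>" x] minus[of "real_of_int k * x"]
    by (cases "k \<ge> 0") auto
  have rat: "f q = f 1 * q" if q: "q \<in> \<rat>" for q
  proof -
    obtain a b where ab: "q = real_of_int a / real_of_int b" "b \<noteq> 0"
      using q by (elim Rats_cases') auto
    have "real_of_int b * f q = real_of_int a * f 1"
      using int[of b q] int[of a 1] ab by simp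
    then have "f q = real_of_int a * f 1 / real_of_int b"
      using ab(2) by (simp add: nonzero_eq_divide_eq mult.commute)
    then show ?thesis using ab(1) by simp
  qed
  have "closed {x. f x = f 1 * x}"
    by (intro closed_Collect_eq cont continuous_intros)
  moreover have "\<rat> \<subseteq> {x. f x = f 1 * x}" using rat by blast
  ultimately have "closure \<rat> \<subseteq> {x. f x = f 1 * x}" by (rule closure_minimal[rotated])
  then show ?thesis using Rats_closure_real by auto
qed


section \<open>Conjugation on an open normal copy of the real line\<close>

locale real_open_subgroup = group G for G (structure) +
  fixes T :: "'a topology" and N :: "'a set" and \<theta> :: "'a \<Rightarrow> real"
  assumes tg: "topological_group G T"
    and normal: "N \<lhd> G"
    and open_N: "openin T N"
    and iso: "\<theta> \<in> iso (G\<lparr>carrier := N\<rparr>) real_group"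
    and homeo: "homeomorphic_map (subtopology T N) euclideanreal \<theta>"
begin

sublocale N: normal N G by (rule normal)

lemma topspace_T: "topspace T = carrier G"
  using tg by (simp add: topological_group_def)

lemma conj_in_N: "u \<in> carrier G \<Longrightarrow> g \<in> N \<Longrightarrow> u \<otimes> g \<otimes> inv u \<in> N"
  by (rule N.inv_op_closed2)

definition \<tau> :: "real \<Rightarrow> 'a" where
  "\<tau> = inv_into N \<theta>"

lemma bij_\<theta>: "bij_betw \<theta> N UNIV"
  using iso by (auto simp: iso_def real_group_def)

lemma \<tau>_in_N [simp]: "\<tau> t \<in> N"
  unfolding \<tau>_def using bij_\<theta> by (metis UNIV_I bij_betw_imp_surj_on inv_into_into)

lemma \<tau>_in_carrier [simp]: "\<tau> t \<in> carrier G"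
  using N.subset \<tau>_in_N by blast

lemma \<theta>_\<tau> [simp]: "\<theta> (\<tau> t) = t"
  unfolding \<tau>_def using bij_\<theta> by (metis UNIV_I bij_betw_imp_surj_on f_inv_into_f)

lemma \<tau>_\<theta> [simp]: "g \<in> N \<Longrightarrow> \<tau> (\<theta> g) = g"
  unfolding \<tau>_def using bij_\<theta> by (simp add: bij_betw_imp_inj_on)

lemma \<theta>_inj: "g \<in> N \<Longrightarrow> h \<in> N \<Longrightarrow> \<theta> g = \<theta> h \<Longrightarrow> g = h"
  using \<tau>_\<theta> by metis

lemma \<theta>_mult [simp]: "g \<in> N \<Longrightarrow> h \<in> N \<Longrightarrow> \<theta> (g \<otimes> h) = \<theta> g + \<theta> h"
  using iso by (auto simp: iso_def hom_def real_group_def)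

lemma \<theta>_one [simp]: "\<theta> \<one> = 0"
  using \<theta>_mult[of \<one> \<one>] by simp

lemma \<theta>_inv [simp]: "g \<in> N \<Longrightarrow> \<theta> (inv g) = - \<theta> g"
  using \<theta>_mult[of "inv g" g] by simp

lemma \<tau>_add: "\<tau> (s + t) = \<tau> s \<otimes> \<tau> t"
  by (rule \<theta>_inj) auto

lemma \<tau>_zero [simp]: "\<tau> 0 = \<one>"
  by (rule \<theta>_inj) auto

lemma inv_\<tau>: "inv (\<tau> t) = \<tau> (- t)"
  by (rule \<theta>_inj) auto

lemma \<tau>_diff: "\<tau> (s - t) = \<tau> s \<otimes> inv (\<tau> t)"
  using \<tau>_add[of s "- t"] by (simp add: inv_\<tau>)

lemma continuous_map_\<tau>: "continuous_map euclideanreal T \<tau>"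
proof -
  obtain g where g: "homeomorphic_maps (subtopology T N) euclideanreal \<theta> g"
    using homeo homeomorphic_map_maps by blast
  have topN: "topspace (subtopology T N) = N"
    using topspace_T N.subset by auto
  have "\<theta> (g t) = t" "g t \<in> N" for t
    using g topN by (auto simp: homeomorphic_maps_def continuous_map_def Pi_iff)
  then have "g = \<tau>" using \<tau>_\<theta> by (metis ext)
  then have "continuous_map euclideanreal (subtopology T N) \<tau>"
    using g by (simp add: homeomorphic_maps_def)
  then show ?thesis by (rule continuous_map_into_fulltopology)
qed

lemma continuous_map_\<theta>: "continuous_map (subtopology T N) euclideanreal \<theta>"
  using homeo by (rule homeomorphic_imp_continuous_map)

text \<open>In the coordinate \<open>\<theta>\<close> conjugation is additive and continuous, hence
  multiplication by some \<open>c\<close>. The distance \<open>D t\<close> of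
  \<open>\<tau> t\<close> from the identity is invariant under conjugation, so
  \<open>D 1 = D (c ^ n)\<close>. If \<open>\<bar>c\<bar> < 1\<close> this tends to 0, which is
  impossible; if \<open>\<bar>c\<bar> > 1\<close>, powers of the inverse of \<open>c\<close> give
  the same contradiction.\<close>

lemma TSI_conj:
  assumes "TSI G T" and u: "u \<in> carrier G"
  shows "(\<forall>g\<in>N. \<theta> (u \<otimes> g \<otimes> inv u) = \<theta> g) \<or> (\<forall>g\<in>N. \<theta> (u \<otimes> g \<otimes> inv u) = - \<theta> g)"
proof -
  obtain d where d: "Metric_space (carrier G) d" "Metric_space.mtopology (carrier G) d = T"
    and left: "\<And>x y z. \<lbrakk>x \<in> carrier G; y \<in> carrier G; z \<in> carrier G\<rbrakk> \<Longrightarrow> d (z \<otimes> x) (z \<otimes> y) = d x y"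
    and right: "\<And>x y z. \<lbrakk>x \<in> carrier G; y \<in> carrier G; z \<in> carrier G\<rbrakk> \<Longrightarrow> d (x \<otimes> z) (y \<otimes> z) = d x y"
    using assms(1) unfolding TSI_def by blast
  interpret M: Metric_space "carrier G" d by (rule d(1))
  define \<phi> where "\<phi> t = \<theta> (u \<otimes> \<tau> t \<otimes> inv u)" for t
  define c where "c = \<phi> 1"
  have add: "\<phi> (s + t) = \<phi> s + \<phi> t" for s t
  proof -
    have "u \<otimes> \<tau> (s + t) \<otimes> inv u = (u \<otimes> \<tau> s \<otimes> inv u) \<otimes> (u \<otimes> \<tau> t \<otimes> inv u)"
      using u by (simp add: \<tau>_add m_assoc inv_cancel_left)
    then show ?thesis unfolding \<phi>_def using u by (simp add: conj_in_N)
  qed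
  have "continuous_map euclideanreal T (\<lambda>t. u \<otimes> \<tau> t \<otimes> inv u)"
    using u topspace_T
    by (intro topological_group_continuous_mult[OF tg] continuous_map_\<tau>) auto
  then have "continuous_map euclideanreal (subtopology T N) (\<lambda>t. u \<otimes> \<tau> t \<otimes> inv u)"
    using u by (auto simp: continuous_map_in_subtopology conj_in_N)
  from continuous_map_compose[OF this continuous_map_\<theta>] have "continuous_on UNIV \<phi>"
    by (simp add: o_def \<phi>_def[abs_def])
  then have \<phi>: "\<phi> t = c * t" for t
    unfolding c_def using additive_continuous_real[of \<phi> t] add by blast
  define D where "D t = d (\<tau> t) \<one>" for t
  have D_c: "D (c * t) = D t" for t
  proof -
    have "u \<otimes> \<tau> t \<otimes> inv u = \<tau> (c * t)"
      using u \<phi>[of t] unfolding \<phi>_def by (metis \<tau>_\<theta> \<tau>_in_N conj_in_N)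
    then have "D (c * t) = d (u \<otimes> \<tau> t \<otimes> inv u) (u \<otimes> \<one> \<otimes> inv u)"
      unfolding D_def using u by simp
    also have "\<dots> = D t"
      unfolding D_def using u by (simp only: left right inv_closed m_closed one_closed \<tau>_in_carrier)
    finally show ?thesis .
  qed
  have D_pow: "D (c ^ n * t) = D t" for n t
    by (induction n) (auto simp: D_c mult.assoc)
  have D_tendsto: "(\<lambda>n. D (r n)) \<longlonglongrightarrow> 0" if "r \<longlonglongrightarrow> 0" for r
  proof -
    have "limitin T (\<tau> \<circ> r) (\<tau> 0) sequentially"
      using that by (intro continuous_map_limit[OF continuous_map_\<tau>]) simp
    then have "\<forall>\<epsilon>>0. \<exists>M. \<forall>n\<ge>M. D (r n) < \<epsilon>"
      unfolding d(2)[symmetric] M.limit_metric_sequentially D_def by fastforce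
    then show ?thesis
      unfolding lim_sequentially by (auto simp: D_def dist_real_def)
  qed
  have "D 1 \<noteq> 0"
  proof
    assume "D 1 = 0"
    then have "\<tau> 1 = \<tau> 0" unfolding D_def by (simp add: M.zero)
    then show False using \<theta>_\<tau> by (metis zero_neq_one)
  qed
  have "\<not> \<bar>c\<bar> < 1"
  proof
    assume "\<bar>c\<bar> < 1"
    then have "(\<lambda>n. c ^ n) \<longlonglongrightarrow> 0" by (intro LIMSEQ_power_zero) simp
    from D_tendsto[OF this] show False
      using D_pow[of _ 1] \<open>D 1 \<noteq> 0\<close> by (simp add: LIMSEQ_const_iff)
  qed
  moreover have "\<not> \<bar>c\<bar> > 1"
  proof
    assume c: "\<bar>c\<bar> > 1"
    then have "(\<lambda>n. inverse c ^ n) \<longlonglongrightarrow> 0"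
      by (intro LIMSEQ_power_zero) (simp add: inverse_less_1_iff)
    moreover have "D (inverse c ^ n) = D 1" for n
      using D_pow[of n "inverse c ^ n"] c by (simp add: power_mult_distrib[symmetric])
    ultimately show False
      using D_tendsto[of "\<lambda>n. inverse c ^ n"] \<open>D 1 \<noteq> 0\<close> by (simp add: LIMSEQ_const_iff)
  qed
  ultimately have c: "c = 1 \<or> c = - 1" by linarith
  have "\<theta> (u \<otimes> g \<otimes> inv u) = c * \<theta> g" if "g \<in> N" for g
    using \<phi>[of "\<theta> g"] that by (simp add: \<phi>_def)
  then show ?thesis using c by (elim disjE) simp_all
qed

end

text \<open>Even terms form \<open>u\<close> and odd terms form \<open>u + w\<close>. Interleaving
  packs two conditions into the convergence of one real sequence.\<close>

lemma convergent_interleave_iff: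
  fixes u w :: "nat \<Rightarrow> real"
  shows "convergent (\<lambda>n. u (n div 2) + (if odd n then w (n div 2) else 0)) \<longleftrightarrow>
    convergent u \<and> w \<longlonglongrightarrow> 0"
proof
  let ?s = "\<lambda>n. u (n div 2) + (if odd n then w (n div 2) else 0)"
  assume "convergent ?s"
  then obtain L where L: "?s \<longlonglongrightarrow> L" by (auto simp: convergent_def)
  have "(\<lambda>m. ?s (2 * m)) \<longlonglongrightarrow> L"
    using LIMSEQ_subseq_LIMSEQ[OF L, of "\<lambda>m. 2 * m"] by (simp add: o_def strict_mono_def)
  then have u: "u \<longlonglongrightarrow> L" by simp
  have "(\<lambda>m. ?s (2 * m + 1)) \<longlonglongrightarrow> L"
    using LIMSEQ_subseq_LIMSEQ[OF L, of "\<lambda>m. 2 * m + 1"] by (simp add: o_def strict_mono_def)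
  then have "(\<lambda>m. u m + w m) \<longlonglongrightarrow> L" by simp
  from tendsto_diff[OF this u] have "w \<longlonglongrightarrow> 0" by simp
  with u show "convergent u \<and> w \<longlonglongrightarrow> 0" by (auto simp: convergent_def)
next
  assume "convergent u \<and> w \<longlonglongrightarrow> 0"
  then obtain L where u: "u \<longlonglongrightarrow> L" and w: "w \<longlonglongrightarrow> 0" by (auto simp: convergent_def)
  have half: "filterlim (\<lambda>n::nat. n div 2) at_top sequentially"
    unfolding filterlim_at_top eventually_sequentially
  proof (intro allI exI impI)
    show "Z \<le> n div 2" if "2 * Z \<le> n" for Z n :: nat using that by simp
  qed
  have "(\<lambda>n. if odd n then w (n div 2) else 0) \<longlonglongrightarrow> 0"
    by (rule Lim_null_comparison[OF _ tendsto_norm_zero[OF filterlim_compose[OF w half]]]) auto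
  from tendsto_add[OF filterlim_compose[OF u half] this]
  show "convergent (\<lambda>n. u (n div 2) + (if odd n then w (n div 2) else 0))"
    by (auto simp: convergent_def)
qed

lemma continuous_map_discrete_pair:
  assumes "continuous_map X (discrete_topology UNIV) f" "continuous_map X (discrete_topology UNIV) g"
  shows "continuous_map X (discrete_topology UNIV) (\<lambda>x. h (f x) (g x))"
proof -
  have "continuous_map X (prod_topology (discrete_topology UNIV) (discrete_topology UNIV)) (\<lambda>x. (f x, g x))"
    using assms by (rule continuous_map_pairedI)
  then have "continuous_map X (discrete_topology (UNIV \<times> UNIV)) (\<lambda>x. (f x, g x))"
    by (simp only: prod_topology_discrete_topology)
  from continuous_map_compose[OF this, of "discrete_topology UNIV" "\<lambda>(a, b). h a b"]
  show ?thesis by (simp add: o_def)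
qed

section \<open>Orientation, coset representatives and limits\<close>

locale signed_real_open_subgroup = real_open_subgroup +
  fixes \<kappa> :: "'a \<Rightarrow> nat"
  assumes \<kappa>: "\<And>x y. x \<in> carrier G \<Longrightarrow> y \<in> carrier G \<Longrightarrow> \<kappa> x = \<kappa> y \<longleftrightarrow> inv x \<otimes> y \<in> N"
    and conj_cases: "\<And>u. u \<in> carrier G \<Longrightarrow>
      (\<forall>g\<in>N. \<theta> (u \<otimes> g \<otimes> inv u) = \<theta> g) \<or> (\<forall>g\<in>N. \<theta> (u \<otimes> g \<otimes> inv u) = - \<theta> g)"
begin

definition orient :: "'a \<Rightarrow> real" where
  "orient u = (if \<forall>g\<in>N. \<theta> (u \<otimes> g \<otimes> inv u) = \<theta> g then 1 else - 1)"

lemma orient_cases: "orient u = 1 \<or> orient u = - 1"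
  by (simp add: orient_def)

lemma orient_square [simp]: "orient u * orient u = 1"
  by (simp add: orient_def)

lemma \<theta>_conj: "u \<in> carrier G \<Longrightarrow> g \<in> N \<Longrightarrow> \<theta> (u \<otimes> g \<otimes> inv u) = orient u * \<theta> g"
  using conj_cases[of u] by (auto simp: orient_def)

text \<open>As \<open>\<theta> (\<tau> 1) = 1\<close>, one conjugate determines the sign, and
  multiplicativity becomes a computation.\<close>

lemma orient_eq: "u \<in> carrier G \<Longrightarrow> orient u = \<theta> (u \<otimes> \<tau> 1 \<otimes> inv u)"
  by (simp add: \<theta>_conj)

lemma orient_mult: 
  assumes "u \<in> carrier G" "v \<in> carrier G"
  shows "orient (u \<otimes> v) = orient u * orient v"
proof -
  have "orient (u \<otimes> v) = \<theta> (u \<otimes> (v \<otimes> \<tau> 1 \<otimes> inv v) \<otimes> inv u)"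
    using assms by (simp add: orient_eq inv_mult_group m_assoc)
  also have "\<dots> = orient u * orient v"
    using assms by (simp add: \<theta>_conj conj_in_N)
  finally show ?thesis .
qed

lemma orient_N: "g \<in> N \<Longrightarrow> orient g = 1"
  by (simp add: orient_eq)

lemma orient_inv: "u \<in> carrier G \<Longrightarrow> orient (inv u) = orient u"
  using orient_mult[of "inv u" u] orient_N[of \<one>] orient_cases[of u] orient_cases[of "inv u"] by auto

lemma orient_cong: "x \<in> carrier G \<Longrightarrow> y \<in> carrier G \<Longrightarrow> inv x \<otimes> y \<in> N \<Longrightarrow> orient x = orient y"
  using orient_mult[of x "inv x \<otimes> y"] orient_N[of "inv x \<otimes> y"] by (simp add: inv_cancel_left)

text \<open>A section of the quotient map in terms of codes. Its value is meaningful only on codes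
  of the form \<open>\<kappa> x\<close>.\<close>

definition \<sigma> :: "nat \<Rightarrow> 'a" where
  "\<sigma> k = (SOME x. x \<in> carrier G \<and> \<kappa> x = k)"

lemma \<sigma>: "x \<in> carrier G \<Longrightarrow> \<sigma> (\<kappa> x) \<in> carrier G" "x \<in> carrier G \<Longrightarrow> \<kappa> (\<sigma> (\<kappa> x)) = \<kappa> x"
  unfolding \<sigma>_def using someI[of "\<lambda>y. y \<in> carrier G \<and> \<kappa> y = \<kappa> x" x] by auto

definition \<rho> :: "'a \<Rightarrow> real" where
  "\<rho> x = \<theta> (inv (\<sigma> (\<kappa> x)) \<otimes> x)"

lemma \<sigma>_\<rho>:
  assumes "x \<in> carrier G"
  shows "inv (\<sigma> (\<kappa> x)) \<otimes> x \<in> N" "x = \<sigma> (\<kappa> x) \<otimes> \<tau> (\<rho> x)"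
proof -
  show N: "inv (\<sigma> (\<kappa> x)) \<otimes> x \<in> N"
    using \<kappa>[of "\<sigma> (\<kappa> x)" x] \<sigma>[OF assms] assms by simp
  then show "x = \<sigma> (\<kappa> x) \<otimes> \<tau> (\<rho> x)"
    using assms \<sigma>[OF assms] by (simp add: \<rho>_def inv_cancel_left)
qed

lemma openin_left_coset:
  assumes "a \<in> carrier G" "openin T V"
  shows "openin T {x \<in> carrier G. a \<otimes> x \<in> V}"
  using openin_continuous_map_preimage[OF topological_group_continuous_left_mult[OF tg assms(1)] assms(2)]
  by (simp add: topspace_T)

lemma continuous_map_coset_invariant:
  assumes "\<And>x. x \<in> carrier G \<Longrightarrow> g x \<in> topspace Y"
    and inv: "\<And>x y. x \<in> carrier G \<Longrightarrow> y \<in> carrier G \<Longrightarrow> inv x \<otimes> y \<in> N \<Longrightarrow> g x = g y"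
  shows "continuous_map T Y g"
  unfolding continuous_map_def
proof (intro conjI allI impI)
  show "g \<in> topspace T \<rightarrow> topspace Y" using assms(1) by (simp add: topspace_T)
  fix V assume "openin Y V"
  show "openin T {x \<in> topspace T. g x \<in> V}"
  proof (subst openin_subopen, intro ballI)
    fix x assume "x \<in> {x \<in> topspace T. g x \<in> V}"
    then have x: "x \<in> carrier G" "g x \<in> V" by (auto simp: topspace_T)
    let ?W = "{y \<in> carrier G. inv x \<otimes> y \<in> N}"
    have "openin T ?W" using x open_N by (intro openin_left_coset) auto
    moreover have "x \<in> ?W" using x by simp
    moreover have "?W \<subseteq> {x \<in> topspace T. g x \<in> V}"
      using inv[OF x(1)] x(2) by (auto simp: topspace_T)
    ultimately show "\<exists>W. openin T W \<and> x \<in> W \<and> W \<subseteq> {x \<in> topspace T. g x \<in> V}" by blast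
  qed
qed

text \<open>On each coset, which is open, the representative is fixed and \<open>\<rho>\<close> is
  \<open>\<theta>\<close> after a left translation.\<close>

lemma continuous_map_\<rho>: "continuous_map T euclideanreal \<rho>"
  unfolding continuous_map_def
proof (intro conjI allI impI)
  fix V :: "real set" assume "openin euclideanreal V"
  then have "openin (subtopology T N) {x \<in> topspace (subtopology T N). \<theta> x \<in> V}"
    by (rule openin_continuous_map_preimage[OF continuous_map_\<theta>])
  moreover have "{x \<in> topspace (subtopology T N). \<theta> x \<in> V} = {x \<in> N. \<theta> x \<in> V}"
    using N.subset topspace_T by auto
  ultimately have \<theta>V: "openin T {x \<in> N. \<theta> x \<in> V}"
    using open_N by (simp add: openin_open_subtopology)
  show "openin T {x \<in> topspace T. \<rho> x \<in> V}"
  proof (subst openin_subopen, intro ballI)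
    fix x assume "x \<in> {x \<in> topspace T. \<rho> x \<in> V}"
    then have x: "x \<in> carrier G" "\<rho> x \<in> V" by (auto simp: topspace_T)
    let ?W = "{y \<in> carrier G. inv (\<sigma> (\<kappa> x)) \<otimes> y \<in> {x \<in> N. \<theta> x \<in> V}}"
    have "openin T ?W" using \<sigma>[OF x(1)] by (intro openin_left_coset \<theta>V) auto
    moreover have "x \<in> ?W" using x \<sigma>_\<rho>(1)[OF x(1)] by (simp add: \<rho>_def)
    moreover have "?W \<subseteq> {x \<in> topspace T. \<rho> x \<in> V}"
    proof
      fix y assume y: "y \<in> ?W"
      then have "\<kappa> y = \<kappa> x" using \<kappa>[of "\<sigma> (\<kappa> x)" y] \<sigma>[OF x(1)] by simp
      then show "y \<in> {x \<in> topspace T. \<rho> x \<in> V}" using y by (simp add: \<rho>_def topspace_T)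
    qed
    ultimately show "\<exists>W. openin T W \<and> x \<in> W \<and> W \<subseteq> {x \<in> topspace T. \<rho> x \<in> V}" by blast
  qed
qed simp

text \<open>Since \<open>N\<close> is open, a convergent sequence eventually stays in the coset of
  its limit. Right translation by \<open>inv (z M)\<close> moves this coset onto \<open>N\<close>,
  where \<open>\<theta>\<close> is a homeomorphism.\<close>

lemma limitin_iff_convergent:
  assumes z: "\<And>n. z n \<in> carrier G"
  shows "(\<exists>l. limitin T z l sequentially) \<longleftrightarrow>
    (\<exists>M. (\<forall>n\<ge>M. z n \<otimes> inv (z M) \<in> N) \<and> convergent (\<lambda>n. \<theta> (z n \<otimes> inv (z M))))"
proof
  assume "\<exists>l. limitin T z l sequentially"
  then obtain l where lim: "limitin T z l sequentially" by blast
  then have l: "l \<in> carrier G" using limitin_topspace topspace_T by fastforce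
  have cont: "continuous_map T T (\<lambda>x. x \<otimes> inv a)" if "a \<in> carrier G" for a
    using that topspace_T by (intro topological_group_continuous_mult[OF tg]) auto
  have "limitin T ((\<lambda>x. x \<otimes> inv l) \<circ> z) (l \<otimes> inv l) sequentially"
    by (rule continuous_map_limit[OF cont[OF l] lim])
  then have "\<forall>\<^sub>F n in sequentially. z n \<otimes> inv l \<in> N"
    using l open_N by (simp add: limitin_def)
  then obtain M where M: "\<And>n. n \<ge> M \<Longrightarrow> z n \<otimes> inv l \<in> N"
    by (auto simp: eventually_sequentially)
  have div: "z n \<otimes> inv (z M) \<in> N" if "n \<ge> M" for n
  proof -
    have "z n \<otimes> inv (z M) = (z n \<otimes> inv l) \<otimes> inv (z M \<otimes> inv l)"
      using z[of n] z[of M] l by (simp add: inv_mult_group m_assoc inv_cancel_left)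
    then show ?thesis using M[OF that] M[of M] by simp
  qed
  have "limitin T ((\<lambda>x. x \<otimes> inv (z M)) \<circ> z) (l \<otimes> inv (z M)) sequentially"
    by (rule continuous_map_limit[OF cont[OF z] lim])
  moreover have "l \<otimes> inv (z M) \<in> N"
  proof -
    have "l \<otimes> inv (z M) = inv (z M \<otimes> inv l)" using z[of M] l by (simp add: inv_mult_group)
    then show ?thesis using M[of M] by simp
  qed
  ultimately have "limitin (subtopology T N) ((\<lambda>x. x \<otimes> inv (z M)) \<circ> z) (l \<otimes> inv (z M)) sequentially"
    using div by (auto simp: limitin_subtopology eventually_sequentially)
  from continuous_map_limit[OF continuous_map_\<theta> this]
  have "convergent (\<lambda>n. \<theta> (z n \<otimes> inv (z M)))" by (auto simp: o_def convergent_def)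
  then show "\<exists>M. (\<forall>n\<ge>M. z n \<otimes> inv (z M) \<in> N) \<and> convergent (\<lambda>n. \<theta> (z n \<otimes> inv (z M)))"
    using div by blast
next
  assume "\<exists>M. (\<forall>n\<ge>M. z n \<otimes> inv (z M) \<in> N) \<and> convergent (\<lambda>n. \<theta> (z n \<otimes> inv (z M)))"
  then obtain M t where M: "\<And>n. n \<ge> M \<Longrightarrow> z n \<otimes> inv (z M) \<in> N"
    and t: "(\<lambda>n. \<theta> (z n \<otimes> inv (z M))) \<longlonglongrightarrow> t"
    by (auto simp: convergent_def)
  have "continuous_map euclideanreal T (\<lambda>s. \<tau> s \<otimes> z M)"
    using z topspace_T by (intro topological_group_continuous_mult[OF tg] continuous_map_\<tau>) auto
  from continuous_map_limit[OF this, of "\<lambda>n. \<theta> (z n \<otimes> inv (z M))" t sequentially] t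
  have lim: "limitin T (\<lambda>n. \<tau> (\<theta> (z n \<otimes> inv (z M))) \<otimes> z M) (\<tau> t \<otimes> z M) sequentially"
    by (simp add: o_def)
  have "\<forall>\<^sub>F n in sequentially. \<tau> (\<theta> (z n \<otimes> inv (z M))) \<otimes> z M = z n"
    unfolding eventually_sequentially
  proof (intro exI allI impI)
    show "\<tau> (\<theta> (z n \<otimes> inv (z M))) \<otimes> z M = z n" if "n \<ge> M" for n
      using M[OF that] z[of n] z[of M] by (simp add: m_assoc)
  qed
  from limitin_transform_eventually[OF this lim] show "\<exists>l. limitin T z l sequentially" ..
qed

text \<open>The quotient of \<open>z n\<close> by \<open>z M\<close> telescopes into a product of
  increments in \<open>N\<close>, which \<open>\<theta>\<close> turns into a sum.\<close>

lemma limitin_iff_summable_increments: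
  assumes z: "\<And>n. z n \<in> carrier G"
  shows "(\<exists>l. limitin T z l sequentially) \<longleftrightarrow>
    (\<exists>M. (\<forall>n\<ge>M. z (Suc n) \<otimes> inv (z n) \<in> N) \<and>
         convergent (\<lambda>n. \<Sum>i<n. \<theta> (z (Suc (i + M)) \<otimes> inv (z (i + M)))))"
proof -
  have "(\<forall>n\<ge>M. z n \<otimes> inv (z M) \<in> N) \<and> convergent (\<lambda>n. \<theta> (z n \<otimes> inv (z M))) \<longleftrightarrow>
      (\<forall>n\<ge>M. z (Suc n) \<otimes> inv (z n) \<in> N) \<and>
         convergent (\<lambda>n. \<Sum>i<n. \<theta> (z (Suc (i + M)) \<otimes> inv (z (i + M))))" for M
  proof -
    have step: "z (Suc n) \<otimes> inv (z M) = (z (Suc n) \<otimes> inv (z n)) \<otimes> (z n \<otimes> inv (z M))" for n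
      using z[of n] z[of "Suc n"] z[of M] by (simp add: m_assoc inv_cancel_left)
    have step': "z (Suc n) \<otimes> inv (z n) = (z (Suc n) \<otimes> inv (z M)) \<otimes> inv (z n \<otimes> inv (z M))" for n
      using z[of n] z[of "Suc n"] z[of M] by (simp add: m_assoc inv_mult_group inv_cancel_left)
    have sum: "z (n + M) \<otimes> inv (z M) \<in> N \<and>
        \<theta> (z (n + M) \<otimes> inv (z M)) = (\<Sum>i<n. \<theta> (z (Suc (i + M)) \<otimes> inv (z (i + M))))"
      if "\<forall>n\<ge>M. z (Suc n) \<otimes> inv (z n) \<in> N" for n
    proof (induction n)
      case (Suc n)
      then show ?case using that[rule_format, of "n + M"] step[of "n + M"] by simp
    qed (use z in simp)
    have iff: "(\<forall>n\<ge>M. z n \<otimes> inv (z M) \<in> N) \<longleftrightarrow> (\<forall>n\<ge>M. z (Suc n) \<otimes> inv (z n) \<in> N)"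
    proof
      assume *: "\<forall>n\<ge>M. z n \<otimes> inv (z M) \<in> N"
      show "\<forall>n\<ge>M. z (Suc n) \<otimes> inv (z n) \<in> N"
      proof (intro allI impI)
        fix n assume "n \<ge> M"
        then have "z (Suc n) \<otimes> inv (z M) \<in> N" "inv (z n \<otimes> inv (z M)) \<in> N" using * by auto
        then show "z (Suc n) \<otimes> inv (z n) \<in> N" unfolding step' by (rule N.m_closed)
      qed
    next
      assume *: "\<forall>n\<ge>M. z (Suc n) \<otimes> inv (z n) \<in> N"
      show "\<forall>n\<ge>M. z n \<otimes> inv (z M) \<in> N"
      proof (intro allI impI)
        fix n assume "n \<ge> M"
        then show "z n \<otimes> inv (z M) \<in> N" using sum[OF *, of "n - M"] by simp
      qed
    qed
    have "convergent (\<lambda>n. \<theta> (z n \<otimes> inv (z M))) \<longleftrightarrow>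
         convergent (\<lambda>n. \<Sum>i<n. \<theta> (z (Suc (i + M)) \<otimes> inv (z (i + M))))"
      if "\<forall>n\<ge>M. z (Suc n) \<otimes> inv (z n) \<in> N"
      using sum[OF that] convergent_ignore_initial_segment[of "\<lambda>n. \<theta> (z n \<otimes> inv (z M))" M] by simp
    then show ?thesis using iff by blast
  qed
  then show ?thesis unfolding limitin_iff_convergent[OF z] by simp
qed

end

section \<open>The reductions\<close>

lemma eventually_half_iff:
  "(\<forall>\<^sub>F n in sequentially. P (n div 2)) \<longleftrightarrow> (\<forall>\<^sub>F m in sequentially. P m)" for P :: "nat \<Rightarrow> bool"
proof
  assume "\<forall>\<^sub>F n in sequentially. P (n div 2)"
  then obtain M where M: "\<And>n. n \<ge> M \<Longrightarrow> P (n div 2)" by (auto simp: eventually_sequentially)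
  have "P m" if "m \<ge> M" for m using M[of "2 * m"] that by simp
  then show "\<forall>\<^sub>F m in sequentially. P m" by (auto simp: eventually_sequentially)
next
  assume "\<forall>\<^sub>F m in sequentially. P m"
  then obtain M where M: "\<And>m. m \<ge> M \<Longrightarrow> P m" by (auto simp: eventually_sequentially)
  have "P (n div 2)" if "n \<ge> 2 * M" for n using M[of "n div 2"] that by simp
  then show "\<forall>\<^sub>F n in sequentially. P (n div 2)" by (auto simp: eventually_sequentially)
qed

lemma topspace_seq_topology: "x \<in> topspace (seq_topology T) \<longleftrightarrow> (\<forall>n. x n \<in> topspace T)"
  by (auto simp: seq_topology_def PiE_iff)

lemma continuous_map_seq_coordinate: "continuous_map (seq_topology T) T (\<lambda>x. x n)"
  unfolding seq_topology_def by (rule continuous_map_product_projection) simp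

section \<open>Reducing E(G) to the model groups, and the real line to G\<close>

context signed_real_open_subgroup
begin

definition incr :: "(nat \<Rightarrow> 'a) \<Rightarrow> nat \<Rightarrow> 'a" where
  "incr x n = inv (x n) \<otimes> x (Suc n)"

text \<open>The sign belongs to the time after the step: the factor
  \<open>\<tau> (\<rho> (incr x i))\<close> stands to the right of \<open>x i\<close> and of the
  coset representative, whose product has the orientation of \<open>x (Suc i)\<close>.\<close>

definition drift :: "(nat \<Rightarrow> 'a) \<Rightarrow> nat \<Rightarrow> real" where
  "drift x m = (\<Sum>i<m. orient (x (Suc i)) * \<rho> (incr x i))"

text \<open>The even entries carry the position and the orientation, and each odd entry differs from its
  predecessor by the code of the coset of the next increment. As codes are integers, convergence
  forces them to agree eventually.\<close>

definition encode :: "(nat \<Rightarrow> 'a) \<Rightarrow> nat \<Rightarrow> nat \<times> real" where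
  "encode x n = (if orient (x (n div 2)) = 1 then 0 else 1,
     drift x (n div 2) + (if odd n then orient (x (n div 2)) * real (\<kappa> (incr x (n div 2))) else 0))"

lemma incr_closed: "\<lbrakk>\<And>n. x n \<in> carrier G\<rbrakk> \<Longrightarrow> incr x n \<in> carrier G"
  by (simp add: incr_def)

lemma orient_Suc:
  assumes "\<And>n. x n \<in> carrier G"
  shows "orient (x (Suc n)) = orient (x n) * orient (incr x n)"
proof -
  have "x (Suc n) = x n \<otimes> incr x n"
    using assms by (simp add: incr_def inv_cancel_left)
  then show ?thesis using orient_mult[of "x n" "incr x n"] assms incr_closed[of x n] by simp
qed

lemma conj_in_N_iff:
  assumes "u \<in> carrier G" "g \<in> carrier G"
  shows "u \<otimes> g \<otimes> inv u \<in> N \<longleftrightarrow> g \<in> N"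
proof
  assume "u \<otimes> g \<otimes> inv u \<in> N"
  from N.inv_op_closed1[OF assms(1) this] show "g \<in> N"
    using assms by (simp add: m_assoc inv_cancel_left)
qed (use assms conj_in_N in blast)

text \<open>By normality left and right cosets coincide. \<open>\<kappa>\<close> tests the left
  quotient, whereas E(G) involves right quotients.\<close>

lemma \<kappa>_eq_iff:
  assumes "a \<in> carrier G" "b \<in> carrier G"
  shows "\<kappa> a = \<kappa> b \<longleftrightarrow> a \<otimes> inv b \<in> N"
proof -
  have "inv a \<otimes> b \<in> N \<longleftrightarrow> inv (inv a \<otimes> b) \<in> N"
    using assms by (metis N.m_inv_closed inv_closed inv_inv m_closed)
  also have "\<dots> \<longleftrightarrow> b \<otimes> inv (inv a \<otimes> b) \<otimes> inv b \<in> N"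
    using assms by (simp add: conj_in_N_iff)
  also have "b \<otimes> inv (inv a \<otimes> b) \<otimes> inv b = a \<otimes> inv b"
    using assms by (simp add: inv_mult_group m_assoc inv_cancel_left)
  finally show ?thesis using \<kappa>[OF assms] by simp
qed

text \<open>The increment of \<open>z\<close> is the quotient of the increments of \<open>x\<close>
  and \<open>y\<close>, conjugated by \<open>x n\<close>. For equal codes these increments are
  \<open>s \<otimes> p\<close> and \<open>s \<otimes> q\<close>, so \<open>p \<otimes> inv q\<close>
  gets conjugated by \<open>s\<close> and by \<open>x n\<close>; the two signs multiply to the
  orientation of \<open>x (Suc n)\<close>.\<close>

lemma quotient_increment:
  assumes x: "\<And>n. x n \<in> carrier G" and y: "\<And>n. y n \<in> carrier G"
  defines "z \<equiv> \<lambda>n. x n \<otimes> inv (y n)"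
  shows "z (Suc n) \<otimes> inv (z n) \<in> N \<longleftrightarrow> \<kappa> (incr x n) = \<kappa> (incr y n)"
    "\<kappa> (incr x n) = \<kappa> (incr y n) \<Longrightarrow>
       \<theta> (z (Suc n) \<otimes> inv (z n)) = orient (x (Suc n)) * (\<rho> (incr x n) - \<rho> (incr y n))"
proof -
  note ix = incr_closed[of x n, OF x] and iy = incr_closed[of y n, OF y]
  have z: "z (Suc n) \<otimes> inv (z n) = x n \<otimes> (incr x n \<otimes> inv (incr y n)) \<otimes> inv (x n)"
    using x[of n] x[of "Suc n"] y[of n] y[of "Suc n"] unfolding z_def incr_def
    by (simp add: inv_mult_group m_assoc inv_cancel_left)
  show "z (Suc n) \<otimes> inv (z n) \<in> N \<longleftrightarrow> \<kappa> (incr x n) = \<kappa> (incr y n)"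
    unfolding z using x ix iy by (simp add: conj_in_N_iff \<kappa>_eq_iff)
  assume eq: "\<kappa> (incr x n) = \<kappa> (incr y n)"
  define s where "s = \<sigma> (\<kappa> (incr x n))"
  have s: "s \<in> carrier G" using \<sigma>(1)[OF ix] by (simp add: s_def)
  define p q where "p = \<tau> (\<rho> (incr x n))" and "q = \<tau> (\<rho> (incr y n))"
  have pq: "p \<in> N" "q \<in> N" "p \<in> carrier G" "q \<in> carrier G" by (simp_all add: p_def q_def)
  have px: "incr x n = s \<otimes> p" and qy: "incr y n = s \<otimes> q"
    using \<sigma>_\<rho>(2)[OF ix] \<sigma>_\<rho>(2)[OF iy] eq by (simp_all add: s_def p_def q_def)
  have "incr x n \<otimes> inv (incr y n) = s \<otimes> (p \<otimes> inv q) \<otimes> inv s"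
    unfolding px qy using s pq(3,4) by (simp add: inv_mult_group m_assoc)
  then have "\<theta> (z (Suc n) \<otimes> inv (z n)) = orient (x n) * (orient s * (\<theta> p - \<theta> q))"
    unfolding z using x s pq(1,2) by (simp add: \<theta>_conj conj_in_N)
  moreover have "orient (incr x n) = orient s"
    unfolding px using s pq by (simp add: orient_mult orient_N)
  ultimately show "\<theta> (z (Suc n) \<otimes> inv (z n)) = orient (x (Suc n)) * (\<rho> (incr x n) - \<rho> (incr y n))"
    using orient_Suc[of x n, OF x] by (simp add: p_def q_def)
qed

lemma orient_incr_cong:
  assumes "\<And>n. x n \<in> carrier G" "\<And>n. y n \<in> carrier G" "\<kappa> (incr x n) = \<kappa> (incr y n)"
  shows "orient (incr x n) = orient (incr y n)"
  using assms \<kappa>[of "incr x n" "incr y n"] incr_closed[of x n] incr_closed[of y n]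
  by (intro orient_cong) auto

lemma E_rel_iff_increments:
  assumes x: "\<And>n. x n \<in> carrier G" and y: "\<And>n. y n \<in> carrier G"
  shows "(x, y) \<in> E_rel G T \<longleftrightarrow>
    (\<exists>M. (\<forall>n\<ge>M. \<kappa> (incr x n) = \<kappa> (incr y n)) \<and>
      convergent (\<lambda>n. \<Sum>i<n. orient (x (Suc (i + M))) * (\<rho> (incr x (i + M)) - \<rho> (incr y (i + M)))))"
proof -
  let ?z = "\<lambda>n. x n \<otimes> inv (y n)"
  have z: "?z n \<in> carrier G" for n using x y by simp
  have sum: "(\<Sum>i<n. \<theta> (?z (Suc (i + M)) \<otimes> inv (?z (i + M)))) =
      (\<Sum>i<n. orient (x (Suc (i + M))) * (\<rho> (incr x (i + M)) - \<rho> (incr y (i + M))))"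
    if "\<forall>n\<ge>M. \<kappa> (incr x n) = \<kappa> (incr y n)" for M n
    using that by (intro sum.cong refl quotient_increment(2)[OF x y]) simp
  have mem: "?z (Suc n) \<otimes> inv (?z n) \<in> N \<longleftrightarrow> \<kappa> (incr x n) = \<kappa> (incr y n)" for n
    by (rule quotient_increment(1)[OF x y])
  have "(x, y) \<in> E_rel G T \<longleftrightarrow> (\<exists>l. limitin T ?z l sequentially)"
    using x y by (simp add: E_rel_def)
  also have "\<dots> \<longleftrightarrow> (\<exists>M. (\<forall>n\<ge>M. \<kappa> (incr x n) = \<kappa> (incr y n)) \<and>
      convergent (\<lambda>n. \<Sum>i<n. \<theta> (?z (Suc (i + M)) \<otimes> inv (?z (i + M)))))"
    unfolding limitin_iff_summable_increments[of ?z, OF z]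
    by (simp only: mem)
  also have "\<dots> \<longleftrightarrow> (\<exists>M. (\<forall>n\<ge>M. \<kappa> (incr x n) = \<kappa> (incr y n)) \<and>
      convergent (\<lambda>n. \<Sum>i<n. orient (x (Suc (i + M))) * (\<rho> (incr x (i + M)) - \<rho> (incr y (i + M)))))"
    by (intro arg_cong[where f=Ex] ext conj_cong refl) (simp only: sum)
  finally show ?thesis .
qed

lemma E_rel_encode:
  assumes x: "\<And>n. x n \<in> carrier G" and y: "\<And>n. y n \<in> carrier G"
  shows "(encode x, encode y) \<in> E_rel Z2_ltimes_R Z2_ltimes_R_topology \<longleftrightarrow> (x, y) \<in> E_rel G T"
proof -
  define q where "q m = orient (x m) * orient (y m)" for m
  define u where "u c m = drift x m - c * drift y m" for c m
  define w where "w c m = orient (x m) * real (\<kappa> (incr x m)) - c * (orient (y m) * real (\<kappa> (incr y m)))" for c m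
  define S where "S M n = (\<Sum>i<n. orient (x (Suc (i + M))) * (\<rho> (incr x (i + M)) - \<rho> (incr y (i + M))))" for M n
  have sign: "(-1) ^ fst (encode x n) = orient (x (n div 2))" for x n
    using orient_cases[of "x (n div 2)"] by (auto simp: encode_def)
  have snd: "snd (encode x n) - c * snd (encode y n) =
      u c (n div 2) + (if odd n then w c (n div 2) else 0)" for c n
    by (auto simp: encode_def u_def w_def algebra_simps)
  have E_Z2: "(encode x, encode y) \<in> E_rel Z2_ltimes_R Z2_ltimes_R_topology \<longleftrightarrow>
      (\<exists>c. (\<forall>\<^sub>F m in sequentially. q m = c) \<and> convergent (u c) \<and> w c \<longlonglongrightarrow> 0)"
  proof -
    have "(encode x, encode y) \<in> E_rel Z2_ltimes_R Z2_ltimes_R_topology \<longleftrightarrow>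
      (\<exists>c. (\<forall>\<^sub>F n in sequentially. (-1) ^ fst (encode x n) * (-1) ^ fst (encode y n) = c) \<and>
           convergent (\<lambda>n. snd (encode x n) - c * snd (encode y n)))"
      by (rule E_rel_Z2_ltimes_R) (simp_all add: encode_def)
    also have "\<dots> \<longleftrightarrow> (\<exists>c. (\<forall>\<^sub>F n in sequentially. q (n div 2) = c) \<and> convergent (u c) \<and> w c \<longlonglongrightarrow> 0)"
      unfolding sign snd convergent_interleave_iff q_def ..
    also have "\<dots> \<longleftrightarrow> (\<exists>c. (\<forall>\<^sub>F m in sequentially. q m = c) \<and> convergent (u c) \<and> w c \<longlonglongrightarrow> 0)"
      using eventually_half_iff[of "\<lambda>m. q m = c" for c] by simp
    finally show ?thesis .
  qed
  \<comment> \<open>A constant product of orientations converts signs of \<open>y\<close> into signs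
    of \<open>x\<close>, so the two drifts combine into the single series \<open>S\<close>.\<close>
  have c_y: "c * orient (y m) = orient (x m)" if "q m = c" for c m
    using that[symmetric] by (simp add: q_def)
  have u_S: "u c (n + M) = u c M + S M n" if qc: "\<And>n. n \<ge> M \<Longrightarrow> q n = c" for c M n
  proof (induction n)
    case 0
    show ?case by (simp add: S_def)
  next
    case (Suc n)
    have "u c (Suc (n + M)) - u c (n + M) =
        orient (x (Suc (n + M))) * \<rho> (incr x (n + M)) - c * orient (y (Suc (n + M))) * \<rho> (incr y (n + M))"
      by (simp add: u_def drift_def algebra_simps)
    also have "c * orient (y (Suc (n + M))) = orient (x (Suc (n + M)))"
      by (rule c_y) (simp add: qc)
    finally show ?case using Suc.IH by (simp add: S_def algebra_simps)
  qed
  have conv_iff: "convergent (u c) \<longleftrightarrow> convergent (S M)" if qc: "\<And>n. n \<ge> M \<Longrightarrow> q n = c" for c M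
  proof -
    have "convergent (u c) \<longleftrightarrow> convergent (\<lambda>n. u c (n + M))"
      by (simp add: convergent_ignore_initial_segment)
    also have "\<dots> \<longleftrightarrow> convergent (\<lambda>n. u c M + S M n)" using u_S[OF qc] by simp
    also have "\<dots> \<longleftrightarrow> convergent (S M)" by (rule convergent_add_const_iff)
    finally show ?thesis .
  qed
  show ?thesis
    unfolding E_Z2 E_rel_iff_increments[OF x y] S_def[symmetric, abs_def]
  proof
    assume "\<exists>c. (\<forall>\<^sub>F m in sequentially. q m = c) \<and> convergent (u c) \<and> w c \<longlonglongrightarrow> 0"
    then obtain c where c: "\<forall>\<^sub>F m in sequentially. q m = c" "convergent (u c)" "w c \<longlonglongrightarrow> 0" by blast
    have "\<forall>\<^sub>F m in sequentially. \<bar>w c m\<bar> < 1"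
      using order_tendstoD(2)[OF tendsto_rabs_zero[OF c(3)], of 1] by simp
    from eventually_conj[OF c(1) this] obtain M where M: "\<And>m. m \<ge> M \<Longrightarrow> q m = c \<and> \<bar>w c m\<bar> < 1"
      unfolding eventually_sequentially by blast
    have "\<kappa> (incr x m) = \<kappa> (incr y m)" if "m \<ge> M" for m
    proof -
      have "w c m = orient (x m) * (real (\<kappa> (incr x m)) - real (\<kappa> (incr y m)))"
        unfolding w_def mult.assoc[symmetric] using c_y[of m c] M[OF that]
        by (simp only: right_diff_distrib)
      then have "\<bar>real (\<kappa> (incr x m)) - real (\<kappa> (incr y m))\<bar> < 1"
        using M[OF that] orient_cases[of "x m"] by (auto simp: abs_mult)
      then show ?thesis by linarith
    qed
    moreover have "convergent (S M)" using conv_iff[of M c] M c(2) by blast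
    ultimately show "\<exists>M. (\<forall>n\<ge>M. \<kappa> (incr x n) = \<kappa> (incr y n)) \<and> convergent (S M)" by blast
  next
    assume "\<exists>M. (\<forall>n\<ge>M. \<kappa> (incr x n) = \<kappa> (incr y n)) \<and> convergent (S M)"
    then obtain M where M: "\<And>n. n \<ge> M \<Longrightarrow> \<kappa> (incr x n) = \<kappa> (incr y n)" and S: "convergent (S M)"
      by blast
    define c where "c = q M"
    \<comment> \<open>Increments in the same coset have the same orientation, so equal codes already
      make \<open>q\<close> constant.\<close>
    have qc: "q n = c" if "n \<ge> M" for n
      using that
    proof (induction n rule: dec_induct)
      case (step n)
      have "q (Suc n) = q n * (orient (incr y n) * orient (incr y n))"
        using orient_Suc[of x n, OF x] orient_Suc[of y n, OF y] orient_incr_cong[OF x y M[OF step(1)]]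
        by (simp only: q_def ac_simps)
      then show ?case using step.IH by simp
    qed (simp add: c_def)
    have "w c m = 0" if "m \<ge> M" for m
      using M[OF that] c_y[OF qc[OF that]] by (simp add: w_def mult.assoc[symmetric])
    then have "w c \<longlonglongrightarrow> 0"
      by (intro tendsto_eventually) (auto simp: eventually_sequentially)
    moreover have "\<forall>\<^sub>F m in sequentially. q m = c"
      using qc by (auto simp: eventually_sequentially)
    ultimately show "\<exists>c. (\<forall>\<^sub>F m in sequentially. q m = c) \<and> convergent (u c) \<and> w c \<longlonglongrightarrow> 0"
      using conv_iff[of M c, OF qc] S by blast
  qed
qed

lemma topspace_seq_T: "x \<in> topspace (seq_topology T) \<longleftrightarrow> (\<forall>n. x n \<in> carrier G)"
  by (simp add: topspace_seq_topology topspace_T)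

lemma continuous_map_encode: "continuous_map (seq_topology T) (seq_topology Z2_ltimes_R_topology) encode"
proof -
  let ?X = "seq_topology T"
  have incr: "continuous_map ?X T (\<lambda>x. incr x n)" for n
    unfolding incr_def
    by (intro topological_group_continuous_mult[OF tg] topological_group_continuous_inv[OF tg]
        continuous_map_seq_coordinate)
  have orient: "continuous_map ?X euclideanreal (\<lambda>x. orient (x n))" for n
  proof -
    have "continuous_map T euclideanreal orient"
      by (rule continuous_map_coset_invariant[OF _ orient_cong]) simp
    from continuous_map_compose[OF continuous_map_seq_coordinate this] show ?thesis
      by (simp add: o_def)
  qed
  have \<rho>: "continuous_map ?X euclideanreal (\<lambda>x. \<rho> (incr x n))" for n
    using continuous_map_compose[OF incr continuous_map_\<rho>] by (simp add: o_def)
  have "continuous_map T euclideanreal (\<lambda>g. real (\<kappa> g))"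
    using \<kappa> by (intro continuous_map_coset_invariant) simp_all
  from continuous_map_compose[OF incr this]
  have code: "continuous_map ?X euclideanreal (\<lambda>x. real (\<kappa> (incr x n)))" for n by (simp add: o_def)
  have drift: "continuous_map ?X euclideanreal (\<lambda>x. drift x m)" for m
    unfolding drift_def by (intro continuous_map_sum continuous_map_real_mult orient \<rho>) simp
  have "continuous_map T (discrete_topology {0, 1::nat}) (\<lambda>g. if orient g = 1 then 0 else 1)"
  proof (rule continuous_map_coset_invariant)
    show "(if orient g = 1 then 0 else 1) = (if orient h = 1 then 0 else (1::nat))"
      if "g \<in> carrier G" "h \<in> carrier G" "inv g \<otimes> h \<in> N" for g h
      using orient_cong[OF that] by simp
  qed simp
  from continuous_map_compose[OF continuous_map_seq_coordinate this]
  have parity: "continuous_map ?X (discrete_topology {0, 1::nat}) (\<lambda>x. if orient (x n) = 1 then 0 else 1)" for n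
    by (simp add: o_def)
  have pos: "continuous_map ?X euclideanreal
      (\<lambda>x. drift x m + (if b then orient (x m) * real (\<kappa> (incr x m)) else 0))" for m b
    by (cases b) (auto intro!: continuous_map_add continuous_map_real_mult drift orient code)
  show ?thesis
    unfolding seq_topology_def[of Z2_ltimes_R_topology] continuous_map_componentwise_UNIV
    unfolding encode_def Z2_ltimes_R_topology_def
    by (intro allI continuous_map_pairedI parity pos)
qed

lemma borel_reducible_Z2_ltimes_R:
  "borel_reducible (seq_topology T) (E_rel G T)
     (seq_topology Z2_ltimes_R_topology) (E_rel Z2_ltimes_R Z2_ltimes_R_topology)"
  using continuous_map_encode E_rel_encode
  by (intro borel_reducible_continuous_map) (auto simp: topspace_seq_T)

text \<open>Without orientation reversal the first coordinate of \<open>encode\<close> is constantly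
  0, and the second one alone is a reduction.\<close>

lemma borel_reducible_to_real_group:
  assumes "\<And>u. u \<in> carrier G \<Longrightarrow> orient u = 1"
  shows "borel_reducible (seq_topology T) (E_rel G T) (seq_topology euclideanreal) (E_rel real_group euclideanreal)"
proof (rule borel_reducible_continuous_map)
  have "continuous_map (seq_topology T) Z2_ltimes_R_topology (\<lambda>x. encode x n)" for n
    using continuous_map_compose[OF continuous_map_encode continuous_map_seq_coordinate[of _ n]]
    by (simp add: o_def)
  from continuous_map_compose[OF this, of euclideanreal snd]
  show "continuous_map (seq_topology T) (seq_topology euclideanreal) (\<lambda>x n. snd (encode x n))"
    unfolding seq_topology_def[of euclideanreal] continuous_map_componentwise_UNIV
    by (simp add: o_def Z2_ltimes_R_topology_def continuous_map_snd)
  fix x y assume "x \<in> topspace (seq_topology T)" "y \<in> topspace (seq_topology T)"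
  then have xy: "\<And>n. x n \<in> carrier G" "\<And>n. y n \<in> carrier G" by (auto simp: topspace_seq_T)
  have "fst (encode x n) = 0" "fst (encode y n) = 0" for n
    using assms xy by (simp_all add: encode_def)
  then have "(encode x, encode y) \<in> E_rel Z2_ltimes_R Z2_ltimes_R_topology \<longleftrightarrow>
      convergent (\<lambda>n. snd (encode x n) - snd (encode y n))"
    by (subst E_rel_Z2_ltimes_R) auto
  then show "(x, y) \<in> E_rel G T \<longleftrightarrow>
      ((\<lambda>n. snd (encode x n)), (\<lambda>n. snd (encode y n))) \<in> E_rel real_group euclideanreal"
    using E_rel_encode[OF xy] by (simp add: E_rel_real_group)
qed

lemma borel_reducible_from_real_group:
  "borel_reducible (seq_topology euclideanreal) (E_rel real_group euclideanreal) (seq_topology T) (E_rel G T)"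
proof (rule borel_reducible_continuous_map)
  show "continuous_map (seq_topology euclideanreal) (seq_topology T) (\<lambda>x n. \<tau> (x n))"
    unfolding seq_topology_def[of T] continuous_map_componentwise_UNIV
    using continuous_map_compose[OF continuous_map_seq_coordinate continuous_map_\<tau>] by (simp add: o_def)
  fix x y :: "nat \<Rightarrow> real"
  let ?z = "\<lambda>n. \<tau> (x n) \<otimes> inv (\<tau> (y n))"
  have z: "?z n = \<tau> (x n - y n)" for n
    using \<tau>_add[of "x n" "- y n"] by (simp add: inv_\<tau>)
  have div: "?z n \<otimes> inv (?z M) = \<tau> ((x n - y n) - (x M - y M))" for n M
    unfolding z inv_\<tau> \<tau>_add[symmetric] by (simp add: algebra_simps)
  have "((\<lambda>n. \<tau> (x n)), (\<lambda>n. \<tau> (y n))) \<in> E_rel G T \<longleftrightarrow> (\<exists>l. limitin T ?z l sequentially)"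
    by (simp add: E_rel_def)
  also have "\<dots> \<longleftrightarrow> (\<exists>M. convergent (\<lambda>n. (x n - y n) - (x M - y M)))"
    by (subst limitin_iff_convergent) (simp_all add: div)
  also have "\<dots> \<longleftrightarrow> convergent (\<lambda>n. x n - y n)"
    using convergent_diff_const_right_iff[of "\<lambda>n. x n - y n"] by simp
  finally show "(x, y) \<in> E_rel real_group euclideanreal \<longleftrightarrow>
      ((\<lambda>n. \<tau> (x n)), (\<lambda>n. \<tau> (y n))) \<in> E_rel G T"
    by (simp add: E_rel_real_group)
qed

end

text \<open>An element of orientation \<open>- 1\<close> may have infinite order modulo \<open>N\<close>, so a sequence of parities
  is first lifted to a nondecreasing sequence of exponents.\<close>

primrec lift_parity :: "(nat \<Rightarrow> nat) \<Rightarrow> nat \<Rightarrow> nat" where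
  "lift_parity a 0 = a 0"
| "lift_parity a (Suc n) = lift_parity a n + (a n + a (Suc n)) mod 2"

lemma sign_lift_parity: "(-1 :: real) ^ lift_parity a n = (-1) ^ a n"
proof (induction n)
  case (Suc n)
  have "(-1 :: real) ^ ((a n + a (Suc n)) mod 2) = (-1) ^ a n * (-1) ^ a (Suc n)"
    by (cases "even (a n)"; cases "even (a (Suc n))") (auto simp: mod2_eq_if)
  then show ?case using Suc by (simp add: power_add)
qed simp

section \<open>Reducing the semidirect product to G when some element reverses orientation\<close>

context signed_real_open_subgroup
begin

lemma orient_pow:
  assumes "u \<in> carrier G"
  shows "orient (u [^] (n::nat)) = orient u ^ n"
  using assms by (induction n) (simp_all add: orient_mult orient_N)

text \<open>The pair \<open>(a, t)\<close> is imitated by \<open>\<tau> t\<close> times a power of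
  \<open>u\<close> with exponent of parity \<open>a\<close>. With plain exponents 0 and 1, a
  simultaneous flip of \<open>x\<close> and \<open>y\<close> could replace \<open>u\<close> by
  \<open>inv u\<close> in the quotient, which may leave its coset.\<close>

definition twisted :: "'a \<Rightarrow> (nat \<Rightarrow> nat \<times> real) \<Rightarrow> nat \<Rightarrow> 'a" where
  "twisted u x n = \<tau> (snd (x n)) \<otimes> u [^] lift_parity (\<lambda>i. fst (x i)) n"

lemma continuous_map_twisted:
  assumes u: "u \<in> carrier G"
  shows "continuous_map (seq_topology Z2_ltimes_R_topology) (seq_topology T) (twisted u)"
proof -
  let ?X = "seq_topology Z2_ltimes_R_topology"
  have fst: "continuous_map ?X (discrete_topology UNIV) (\<lambda>x. fst (x n))" for n
  proof -
    have 1: "continuous_map Z2_ltimes_R_topology (discrete_topology {0, 1}) fst"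
      unfolding Z2_ltimes_R_topology_def by (rule continuous_map_fst)
    have 2: "continuous_map (discrete_topology {0, 1}) (discrete_topology UNIV) (\<lambda>k::nat. k)"
      by simp
    show ?thesis
      using continuous_map_compose[OF continuous_map_compose[OF continuous_map_seq_coordinate 1] 2]
      by (simp add: o_def)
  qed
  have lift: "continuous_map ?X (discrete_topology UNIV) (\<lambda>x. lift_parity (\<lambda>i. fst (x i)) n)" for n
  proof (induction n)
    case 0
    show ?case using fst[of 0] by simp
  next
    case (Suc n)
    show ?case
      unfolding lift_parity.simps
      by (rule continuous_map_discrete_pair[OF Suc
            continuous_map_discrete_pair[OF fst[of n] fst[of "Suc n"], of "\<lambda>a b. (a + b) mod 2"]])
  qed
  have "continuous_map (discrete_topology UNIV) T (\<lambda>k::nat. u [^] k)"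
    using u by (simp add: topspace_T)
  from continuous_map_compose[OF lift this]
  have pow: "continuous_map ?X T (\<lambda>x. u [^] lift_parity (\<lambda>i. fst (x i)) n)" for n
    by (simp add: o_def)
  have "continuous_map Z2_ltimes_R_topology euclideanreal snd"
    unfolding Z2_ltimes_R_topology_def by (rule continuous_map_snd)
  from continuous_map_compose[OF continuous_map_compose[OF continuous_map_seq_coordinate this] continuous_map_\<tau>]
  have "continuous_map ?X T (\<lambda>x. \<tau> (snd (x n)))" for n
    by (simp add: o_def)
  then show ?thesis
    unfolding seq_topology_def[of T] continuous_map_componentwise_UNIV
    unfolding twisted_def using pow by (intro allI topological_group_continuous_mult[OF tg])
qed

lemma E_rel_twisted:
  assumes u: "u \<in> carrier G" "orient u = - 1"
    and x: "\<And>n. fst (x n) \<in> {0, 1}" and y: "\<And>n. fst (y n) \<in> {0, 1}"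
  shows "(twisted u x, twisted u y) \<in> E_rel G T \<longleftrightarrow> (x, y) \<in> E_rel Z2_ltimes_R Z2_ltimes_R_topology"
proof -
  define z where "z n = twisted u x n \<otimes> inv (twisted u y n)" for n
  define q where "q n = (-1 :: real) ^ fst (x n) * (-1) ^ fst (y n)" for n
  define A where "A = lift_parity (\<lambda>i. fst (x i))"
  define B where "B = lift_parity (\<lambda>i. fst (y i))"
  have carrier: "twisted u x n \<in> carrier G" for x n using u by (simp add: twisted_def)
  have z: "z n \<in> carrier G" for n by (simp add: z_def carrier)
  have orient_z: "orient (z n) = q n" for n
    using u carrier
    by (simp add: z_def orient_mult orient_inv twisted_def orient_pow orient_N sign_lift_parity q_def)
  have parity: "(fst (x n) + fst (x (Suc n))) mod 2 = (fst (y n) + fst (y (Suc n))) mod 2"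
    if "q n = q (Suc n)" for n
    using x[of n] x[of "Suc n"] y[of n] y[of "Suc n"] that unfolding q_def by auto
  have main: "z n \<otimes> inv (z M) = \<tau> ((snd (x n) - q M * snd (y n)) - (snd (x M) - q M * snd (y M)))"
    if qM: "\<And>n. n \<ge> M \<Longrightarrow> q n = q M" and n: "n \<ge> M" for n M
  proof -
    \<comment> \<open>While \<open>q\<close> is constant, \<open>x\<close> and \<open>y\<close>
      change parity at the same times. Both exponents then grow by the same amount, and
      \<open>b\<close> stays fixed.\<close>
    define b where "b n = u [^] A n \<otimes> inv (u [^] B n)" for n
    have b_carrier: "b n \<in> carrier G" for n using u by (simp add: b_def)
    have b: "b n = b M" using n
    proof (induction n rule: dec_induct)
      case (step n)
      define k where "k = (fst (x n) + fst (x (Suc n))) mod 2"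
      have "q n = q (Suc n)" using qM[of n] qM[of "Suc n"] step(1) by simp
      then have AB: "A (Suc n) = A n + k" "B (Suc n) = B n + k"
        using parity[of n] by (simp_all add: A_def B_def k_def)
      have "b (Suc n) = u [^] A n \<otimes> u [^] k \<otimes> inv (u [^] B n \<otimes> u [^] k)"
        unfolding b_def AB using u by (simp add: nat_pow_mult)
      also have "\<dots> = b n"
        unfolding b_def using u by (simp add: inv_mult_group m_assoc inv_cancel_left)
      finally show ?case using step.IH by simp
    qed simp
    \<comment> \<open>Moving \<open>b n\<close> to the right past the translation of
      \<open>y\<close> multiplies that translation by the orientation of \<open>b n\<close>.\<close>
    have z_b: "z n = \<tau> (snd (x n) - orient (b n) * snd (y n)) \<otimes> b n" for n
    proof -
      have "b n \<otimes> \<tau> (- snd (y n)) \<otimes> inv (b n) = \<tau> (orient (b n) * (- snd (y n)))"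
        using b_carrier[of n] by (intro \<theta>_inj) (simp_all add: conj_in_N \<theta>_conj)
      moreover have "z n = \<tau> (snd (x n)) \<otimes> (b n \<otimes> \<tau> (- snd (y n)) \<otimes> inv (b n)) \<otimes> b n"
        unfolding z_def twisted_def A_def[symmetric] B_def[symmetric] b_def using u
        by (simp add: inv_mult_group inv_\<tau> m_assoc inv_cancel_left)
      ultimately show ?thesis
        using \<tau>_add[of "snd (x n)" "orient (b n) * (- snd (y n))"] by simp
    qed
    have "orient (b M) = q M"
      using orient_z[of M] z_b[of M] b_carrier[of M] by (simp add: orient_mult orient_N)
    then have "z n = \<tau> (snd (x n) - q M * snd (y n)) \<otimes> b M" "z M = \<tau> (snd (x M) - q M * snd (y M)) \<otimes> b M"
      using z_b[of n] z_b[of M] b by simp_all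
    then have "z n \<otimes> inv (z M) = \<tau> (snd (x n) - q M * snd (y n)) \<otimes> inv (\<tau> (snd (x M) - q M * snd (y M)))"
      using b_carrier[of M] by (simp add: inv_mult_group m_assoc inv_cancel_left)
    then show ?thesis by (simp only: \<tau>_diff)
  qed
  have conv_iff: "convergent (\<lambda>n. \<theta> (z n \<otimes> inv (z M))) \<longleftrightarrow> convergent (\<lambda>n. snd (x n) - q M * snd (y n))"
    if qM: "\<And>n. n \<ge> M \<Longrightarrow> q n = q M" for M
  proof -
    let ?d = "\<lambda>n. snd (x n) - q M * snd (y n)"
    have "convergent (\<lambda>n. \<theta> (z n \<otimes> inv (z M))) \<longleftrightarrow> convergent (\<lambda>n. \<theta> (z (n + M) \<otimes> inv (z M)))"
      using convergent_ignore_initial_segment[of "\<lambda>n. \<theta> (z n \<otimes> inv (z M))" M] by simp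
    also have "\<dots> \<longleftrightarrow> convergent (\<lambda>n. ?d (n + M) - ?d M)"
      using main[OF qM] by simp
    also have "\<dots> \<longleftrightarrow> convergent (\<lambda>n. ?d (n + M))" by (rule convergent_diff_const_right_iff)
    also have "\<dots> \<longleftrightarrow> convergent ?d" by (rule convergent_ignore_initial_segment)
    finally show ?thesis .
  qed
  have "(twisted u x, twisted u y) \<in> E_rel G T \<longleftrightarrow> (\<exists>l. limitin T z l sequentially)"
    using carrier by (simp add: E_rel_def z_def[abs_def])
  also have "\<dots> \<longleftrightarrow> (\<exists>M. (\<forall>n\<ge>M. z n \<otimes> inv (z M) \<in> N) \<and> convergent (\<lambda>n. \<theta> (z n \<otimes> inv (z M))))"
    by (rule limitin_iff_convergent[OF z])
  also have "\<dots> \<longleftrightarrow> (\<exists>c. (\<forall>\<^sub>F n in sequentially. q n = c) \<and> convergent (\<lambda>n. snd (x n) - c * snd (y n)))"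
  proof
    assume "\<exists>M. (\<forall>n\<ge>M. z n \<otimes> inv (z M) \<in> N) \<and> convergent (\<lambda>n. \<theta> (z n \<otimes> inv (z M)))"
    then obtain M where M: "\<forall>n\<ge>M. z n \<otimes> inv (z M) \<in> N" "convergent (\<lambda>n. \<theta> (z n \<otimes> inv (z M)))" by blast
    have qM: "q n = q M" if "n \<ge> M" for n
    proof -
      have "q n * q M = 1"
        using orient_N[of "z n \<otimes> inv (z M)"] M(1) that z orient_z by (simp add: orient_mult orient_inv)
      then show ?thesis
        using orient_cases[of "z n"] orient_cases[of "z M"] orient_z by auto
    qed
    have "\<forall>\<^sub>F n in sequentially. q n = q M"
      unfolding eventually_sequentially using qM by blast
    then show "\<exists>c. (\<forall>\<^sub>F n in sequentially. q n = c) \<and> convergent (\<lambda>n. snd (x n) - c * snd (y n))"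
      using conv_iff[OF qM] M(2) by blast
  next
    assume "\<exists>c. (\<forall>\<^sub>F n in sequentially. q n = c) \<and> convergent (\<lambda>n. snd (x n) - c * snd (y n))"
    then obtain c M where c: "\<And>n. n \<ge> M \<Longrightarrow> q n = c" "convergent (\<lambda>n. snd (x n) - c * snd (y n))"
      unfolding eventually_sequentially by blast
    have qM: "q n = q M" if "n \<ge> M" for n using c(1)[OF that] c(1)[of M] by simp
    have "z n \<otimes> inv (z M) \<in> N" if "n \<ge> M" for n
      using main[of M n, OF qM that] by simp
    moreover have "convergent (\<lambda>n. \<theta> (z n \<otimes> inv (z M)))"
      using conv_iff[OF qM] c(1)[of M] c(2) by simp
    ultimately show "\<exists>M. (\<forall>n\<ge>M. z n \<otimes> inv (z M) \<in> N) \<and> convergent (\<lambda>n. \<theta> (z n \<otimes> inv (z M)))" by blast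
  qed
  also have "\<dots> \<longleftrightarrow> (x, y) \<in> E_rel Z2_ltimes_R Z2_ltimes_R_topology"
    unfolding q_def using E_rel_Z2_ltimes_R[OF x y] by simp
  finally show ?thesis .
qed

lemma borel_reducible_from_Z2_ltimes_R:
  assumes "u \<in> carrier G" "orient u = - 1"
  shows "borel_reducible (seq_topology Z2_ltimes_R_topology) (E_rel Z2_ltimes_R Z2_ltimes_R_topology)
           (seq_topology T) (E_rel G T)"
proof (rule borel_reducible_continuous_map[OF continuous_map_twisted[OF assms(1)]])
  fix x y assume "x \<in> topspace (seq_topology Z2_ltimes_R_topology)" "y \<in> topspace (seq_topology Z2_ltimes_R_topology)"
  then have "\<And>n. fst (x n) \<in> {0, 1}" "\<And>n. fst (y n) \<in> {0, 1}"
    by (auto simp: topspace_seq_topology Z2_ltimes_R_topology_def mem_Times_iff)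
  from E_rel_twisted[OF assms this]
  show "(x, y) \<in> E_rel Z2_ltimes_R Z2_ltimes_R_topology \<longleftrightarrow> (twisted u x, twisted u y) \<in> E_rel G T" by simp
qed

lemma transport_inner_automorphisms:
  "transport_along \<theta> N (inner_automorphisms_on G N) = (\<lambda>u t. orient u * t) ` carrier G"
proof -
  have "\<theta> \<circ> (\<lambda>g\<in>N. u \<otimes> g \<otimes> inv u) \<circ> inv_into N \<theta> = (\<lambda>t. orient u * t)" if "u \<in> carrier G" for u
    using that by (auto simp: fun_eq_iff \<tau>_def[symmetric] \<theta>_conj)
  then show ?thesis
    unfolding transport_along_def inner_automorphisms_on_def Setcompr_eq_image image_image
    by (intro image_cong) auto
qed

lemma transport_cases:
  "transport_along \<theta> N (inner_automorphisms_on G N) = {id} \<and> (\<forall>u\<in>carrier G. orient u = 1) \<or>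
   transport_along \<theta> N (inner_automorphisms_on G N) = {id, uminus} \<and> (\<exists>u\<in>carrier G. orient u = - 1)"
proof -
  have id: "(\<lambda>t. orient u * t) = id" if "orient u = 1" for u using that by (auto simp: fun_eq_iff)
  have minus: "(\<lambda>t. orient u * t) = uminus" if "orient u = - 1" for u using that by (auto simp: fun_eq_iff)
  have one: "id \<in> (\<lambda>u t. orient u * t) ` carrier G"
    using id[of \<one>] orient_N[of \<one>] by (metis N.one_closed image_eqI one_closed)
  show ?thesis
  proof (cases "\<forall>u\<in>carrier G. orient u = 1")
    case True
    then have "(\<lambda>u t. orient u * t) ` carrier G \<subseteq> {id}" using id by blast
    then show ?thesis using True one unfolding transport_inner_automorphisms by blast
  next
    case False
    then obtain u where u: "u \<in> carrier G" "orient u = - 1" using orient_cases by blast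
    have "(\<lambda>u t. orient u * t) ` carrier G \<subseteq> {id, uminus}" using id minus orient_cases by blast
    moreover have "uminus \<in> (\<lambda>u t. orient u * t) ` carrier G"
      using minus[OF u(2)] u(1) by (metis image_eqI)
    ultimately show ?thesis using u one unfolding transport_inner_automorphisms by blast
  qed
qed

end

theorem theorem1p8:
  fixes G :: "('a, 'm) monoid_scheme"
    and T :: "'a topology"
    and A :: "('a, 'e::euclidean_space) chart set"
    and \<theta> :: "'a \<Rightarrow> real"
  defines "G\<^sub>0 \<equiv> identity_component G T"
  assumes "lie_group G T A"
    and "separable_space T"
    and "TSI G T"
    and "topological_group_iso (G\<lparr>carrier := G\<^sub>0\<rparr>) (subtopology T G\<^sub>0) real_group euclideanreal \<theta>"
  shows "(E_bireducible G T real_group euclideanreal \<longleftrightarrow>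
            transport_along \<theta> G\<^sub>0 (inner_automorphisms_on G G\<^sub>0) = {id}) \<and>
         (E_bireducible G T Z2_ltimes_R Z2_ltimes_R_topology \<longleftrightarrow>
            transport_along \<theta> G\<^sub>0 (inner_automorphisms_on G G\<^sub>0) = {id, \<lambda>t. - t})"
proof -
  have tg: "topological_group G T" and atlas: "smooth_atlas T A"
    using assms(2) by (auto simp: lie_group_def)
  interpret group G using tg by (simp add: topological_group_def)
  have "\<one>\<^bsub>G\<^esub> \<in> topspace T" using tg by (simp add: topological_group_def)
  then obtain U \<phi> where c: "(U, \<phi>) \<in> A" "\<one>\<^bsub>G\<^esub> \<in> U"
    using atlas unfolding smooth_atlas_def by blast
  then have "is_chart T (U, \<phi>)" using atlas unfolding smooth_atlas_def by blast
  then have open_G0: "openin T G\<^sub>0"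
    unfolding G\<^sub>0_def using openin_identity_component[OF tg, of "(U, \<phi>)"] c by simp
  have normal: "G\<^sub>0 \<lhd> G" unfolding G\<^sub>0_def by (rule normal_identity_component[OF tg])
  interpret real_open_subgroup G T G\<^sub>0 \<theta>
    using assms(5)
    by (intro real_open_subgroup.intro real_open_subgroup_axioms.intro is_group tg normal open_G0)
      (simp_all add: topological_group_iso_def)
  obtain \<kappa> :: "'a \<Rightarrow> nat" where \<kappa>: "\<And>x y. x \<in> carrier G \<Longrightarrow> y \<in> carrier G \<Longrightarrow>
      \<kappa> x = \<kappa> y \<longleftrightarrow> inv\<^bsub>G\<^esub> x \<otimes>\<^bsub>G\<^esub> y \<in> G\<^sub>0"
    using coset_code_exists[OF tg assms(3) N.subgroup_axioms open_G0] by blast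
  interpret signed_real_open_subgroup G T G\<^sub>0 \<theta> \<kappa>
    by (intro signed_real_open_subgroup.intro signed_real_open_subgroup_axioms.intro
        real_open_subgroup_axioms \<kappa> TSI_conj[OF assms(4)])
  let ?R = "seq_topology euclideanreal" and ?ER = "E_rel real_group euclideanreal"
  let ?Z = "seq_topology Z2_ltimes_R_topology" and ?EZ = "E_rel Z2_ltimes_R Z2_ltimes_R_topology"
  have not_Z_R: "\<not> borel_reducible ?Z ?EZ ?R ?ER"
    by (rule not_borel_reducible_Z2_ltimes_R_real_group)
  have neq: "{id, uminus} \<noteq> {id :: real \<Rightarrow> real}"
    by (auto simp: fun_eq_iff intro!: exI[of _ 1])
  \<comment> \<open>In each case one equivalence has both sides true and the other both sides false:
    the wrong bireducibility would, by transitivity, reduce the relation of the semidirect product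
    to that of the real line.\<close>
  show ?thesis
    using transport_cases
  proof (elim disjE conjE)
    assume I: "transport_along \<theta> G\<^sub>0 (inner_automorphisms_on G G\<^sub>0) = {id}"
      and "\<forall>u\<in>carrier G. orient u = 1"
    then have to_R: "borel_reducible (seq_topology T) (E_rel G T) ?R ?ER"
      by (intro borel_reducible_to_real_group) blast
    then have "E_bireducible G T real_group euclideanreal"
      using borel_reducible_from_real_group by (simp add: E_bireducible_def borel_bireducible_def)
    moreover have "\<not> E_bireducible G T Z2_ltimes_R Z2_ltimes_R_topology"
      using borel_reducible_trans[OF _ to_R] not_Z_R by (auto simp: E_bireducible_def borel_bireducible_def)
    ultimately show ?thesis using I neq by simp
  next
    assume I: "transport_along \<theta> G\<^sub>0 (inner_automorphisms_on G G\<^sub>0) = {id, uminus}"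
      and "\<exists>u\<in>carrier G. orient u = - 1"
    then have from_Z: "borel_reducible ?Z ?EZ (seq_topology T) (E_rel G T)"
      using borel_reducible_from_Z2_ltimes_R by blast
    then have "E_bireducible G T Z2_ltimes_R Z2_ltimes_R_topology"
      using borel_reducible_Z2_ltimes_R by (simp add: E_bireducible_def borel_bireducible_def)
    moreover have "\<not> E_bireducible G T real_group euclideanreal"
      using borel_reducible_trans[OF from_Z] not_Z_R by (auto simp: E_bireducible_def borel_bireducible_def)
    ultimately show ?thesis using I neq by simp
  qed
qed

end
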